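(* Let $G$ be an ample groupoid and let $H\subseteq G$ be an open subgroupoid. Then there is an adjunction $(\eta,\epsilon)\colon\mathrm{Ind}^G_H\dashv\mathrm{Res}^H_G$ (so $\mathrm{Ind}^G_H$ is left adjoint to $\mathrm{Res}^H_G$) between the categories of left $H$-modules and left $G$-modules, with unit $\eta\colon\mathrm{id}\Rightarrow\mathrm{Res}^H_G\mathrm{Ind}^G_H$ and counit $\epsilon\colon\mathrm{Ind}^G_H\mathrm{Res}^H_G\Rightarrow\mathrm{id}$ such that for every left $H$-module $M$, left $G$-module $N$, $\zeta\in\mathbb Z[H]$, $m\in M$, $\xi\in\mathbb Z[G_{H^0}]\subseteq\mathbb Z[G]$ and $n\in\mathbb Z[H]\cdot N$, $$\eta_M\colon M\to\mathbb Z[H]\cdot(\mathbb Z[G_{H^0}]\otimes_HM),\qquad \eta_M(\zeta\cdot m)=\zeta\otimes m,$$ $$\epsilon_N\colon\mathbb Z[G_{H^0}]\otimes_H(\mathbb Z[H]\cdot N)\to N,\qquad \epsilon_N(\xi\otimes n)=\xi\cdot n.$$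
   Context: LCH means locally compact Hausdorff. An ample groupoid is an étale topological groupoid $G$ whose unit space $G^0$ is LCH and totally disconnected ($G$ itself need not be Hausdorff). Write $r,s$ for range and source and $G_x=s^{-1}(x)$. For a space $X$ in which every point has an open neighbourhood which is LCH and totally disconnected, $\mathbb Z[X]$ is the group of functions $X\to\mathbb Z$ spanned by the groups $C_c(U,\mathbb Z)$ for $U\subseteq X$ open Hausdorff (functions extended by $0$ outside $U$). The groupoid ring $\mathbb Z[G]$ has multiplication $(\xi*\eta)(g)=\sum_{h\in G_{r(g)}}\xi(h^{-1})\eta(hg)$; it is locally unital (any finite set of elements has a common two-sided idempotent unit). Left $G$-modules are left $\mathbb Z[G]$-modules $M$ that are non-degenerate: $\mathbb Z[G]M=M$. For an open subgroupoid $H\subseteq G$, with unit space $H^0$ (an open subset of $G^0$, not necessarily all of it), extension by zero gives an inclusion of rings $\mathbb Z[H]\subseteq\mathbb Z[G]$. The restriction functor sends a left $G$-module $M$ to the left $H$-module $\mathrm{Res}^H_GM=\mathbb Z[H]\cdot M$ and a $G$-module map to its restriction. Put $G_{H^0}=s^{-1}(H^0)\subseteq G$, an open subset; $\mathbb Z[G_{H^0}]\subseteq\mathbb Z[G]$ is a $\mathbb Z[G]$-$\mathbb Z[H]$-bimodule under multiplication in $\mathbb Z[G]$, and contains $\mathbb Z[H]$. The induction functor sends a left $H$-module $N$ to the left $G$-module $\mathrm{Ind}^G_HN=\mathbb Z[G_{H^0}]\otimes_HN$, where $\otimes_H$ means $\otimes_{\mathbb Z[H]}$. *)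

theory Defs
  imports
    "HOL-Analysis.Abstract_Topological_Spaces"
    "HOL-Algebra.Module"
    "HOL-Algebra.Coset"
    "HOL-Algebra.Generated_Groups"
    "HOL-Algebra.Free_Abelian_Groups"
begin

section \<open>Ample groupoids\<close>

text \<open>The unit space is regarded as a set of arrows, so \<open>src\<close> and \<open>rng\<close> take values in arrows.
  The product \<open>cmp G g h\<close> is meaningful when \<open>src G g = rng G h\<close>.\<close>

record 'g groupoid =
  arr_top :: "'g topology"
  src :: "'g \<Rightarrow> 'g"
  rng :: "'g \<Rightarrow> 'g"
  cmp :: "'g \<Rightarrow> 'g \<Rightarrow> 'g"
  ginv :: "'g \<Rightarrow> 'g"

definition arrows :: "'g groupoid \<Rightarrow> 'g set"
  where "arrows G = topspace (arr_top G)"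

definition units :: "'g groupoid \<Rightarrow> 'g set"
  where "units G = src G ` arrows G"

definition unit_space :: "'g groupoid \<Rightarrow> 'g topology"
  where "unit_space G = subtopology (arr_top G) (units G)"

definition composable :: "'g groupoid \<Rightarrow> ('g \<times> 'g) set"
  where "composable G = {(g, h). g \<in> arrows G \<and> h \<in> arrows G \<and> src G g = rng G h}"

definition groupoid_laws :: "'g groupoid \<Rightarrow> bool"
  where "groupoid_laws G \<longleftrightarrow>
    (\<forall>g\<in>arrows G. src G g \<in> arrows G \<and> rng G g \<in> arrows G
        \<and> src G (src G g) = src G g \<and> rng G (src G g) = src G g
        \<and> src G (rng G g) = rng G g \<and> rng G (rng G g) = rng G g)
  \<and> (\<forall>(g, h)\<in>composable G. cmp G g h \<in> arrows G
        \<and> src G (cmp G g h) = src G h \<and> rng G (cmp G g h) = rng G g)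
  \<and> (\<forall>g h k. (g, h) \<in> composable G \<and> (h, k) \<in> composable G
        \<longrightarrow> cmp G (cmp G g h) k = cmp G g (cmp G h k))
  \<and> (\<forall>g\<in>arrows G. cmp G g (src G g) = g \<and> cmp G (rng G g) g = g)
  \<and> (\<forall>g\<in>arrows G. ginv G g \<in> arrows G
        \<and> src G (ginv G g) = rng G g \<and> rng G (ginv G g) = src G g
        \<and> cmp G g (ginv G g) = rng G g \<and> cmp G (ginv G g) g = src G g)"

definition topological_groupoid :: "'g groupoid \<Rightarrow> bool"
  where "topological_groupoid G \<longleftrightarrow>
    groupoid_laws G
  \<and> continuous_map (subtopology (prod_topology (arr_top G) (arr_top G)) (composable G)) (arr_top G)
      (\<lambda>(g, h). cmp G g h)
  \<and> continuous_map (arr_top G) (arr_top G) (ginv G)"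

definition local_homeomorphism :: "'a topology \<Rightarrow> 'b topology \<Rightarrow> ('a \<Rightarrow> 'b) \<Rightarrow> bool"
  where "local_homeomorphism X Y f \<longleftrightarrow>
    (\<forall>x\<in>topspace X. \<exists>U. x \<in> U \<and> openin X U \<and> openin Y (f ` U)
       \<and> homeomorphic_map (subtopology X U) (subtopology Y (f ` U)) f)"

definition etale_groupoid :: "'g groupoid \<Rightarrow> bool"
  where "etale_groupoid G \<longleftrightarrow>
    topological_groupoid G
  \<and> local_homeomorphism (arr_top G) (unit_space G) (src G)
  \<and> local_homeomorphism (arr_top G) (unit_space G) (rng G)"

definition totally_disconnected_space :: "'a topology \<Rightarrow> bool"
  where "totally_disconnected_space X \<longleftrightarrow> (\<forall>C. connectedin X C \<longrightarrow> (\<exists>x. C \<subseteq> {x}))"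

definition ample_groupoid :: "'g groupoid \<Rightarrow> bool"
  where "ample_groupoid G \<longleftrightarrow>
    etale_groupoid G
  \<and> locally_compact_space (unit_space G) \<and> Hausdorff_space (unit_space G)
  \<and> totally_disconnected_space (unit_space G)"

definition open_subgroupoid :: "'g groupoid \<Rightarrow> 'g groupoid \<Rightarrow> bool"
  where "open_subgroupoid H G \<longleftrightarrow>
    groupoid_laws H
  \<and> openin (arr_top G) (arrows H)
  \<and> arr_top H = subtopology (arr_top G) (arrows H)
  \<and> (\<forall>g\<in>arrows H. src H g = src G g \<and> rng H g = rng G g \<and> ginv H g = ginv G g)
  \<and> (\<forall>(g, h)\<in>composable H. cmp H g h = cmp G g h)"


section \<open>The groupoid ring\<close>

text \<open>The functions in \<open>cc_int X U\<close> are extended by zero from \<open>U\<close> to the whole type. Hence, for an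
  open subset \<open>Y\<close> of \<open>X\<close>, extension by zero from \<open>Y\<close> to \<open>X\<close> is the identity on functions.\<close>

definition cc_int :: "'x topology \<Rightarrow> 'x set \<Rightarrow> ('x \<Rightarrow> int) set"
  where "cc_int X U = {f.
    (\<forall>x. x \<notin> U \<longrightarrow> f x = 0)
  \<and> continuous_map (subtopology X U) (discrete_topology UNIV) f
  \<and> compactin (subtopology X U) (subtopology X U closure_of {x \<in> U. f x \<noteq> 0})}"

definition pointwise_group :: "('x \<Rightarrow> int) monoid"
  where "pointwise_group = \<lparr>carrier = UNIV, mult = (\<lambda>f g x. f x + g x), one = (\<lambda>_. 0)\<rparr>"

definition int_functions :: "'x topology \<Rightarrow> ('x \<Rightarrow> int) set"
  where "int_functions X = generate pointwise_group
    (\<Union>U\<in>{U. openin X U \<and> Hausdorff_space (subtopology X U)}. cc_int X U)"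

text \<open>The fibre \<open>src G -` {rng G g}\<close> can be infinite. The sum runs over its nonzero terms, which are
  finitely many for \<open>\<xi>\<close> and \<open>\<eta>\<close> in the groupoid ring of an ample groupoid.\<close>

definition convolution :: "'g groupoid \<Rightarrow> ('g \<Rightarrow> int) \<Rightarrow> ('g \<Rightarrow> int) \<Rightarrow> 'g \<Rightarrow> int"
  where "convolution G \<xi> \<eta> g =
    (if g \<in> arrows G
     then \<Sum>h | h \<in> arrows G \<and> src G h = rng G g \<and> \<xi> (ginv G h) * \<eta> (cmp G h g) \<noteq> 0.
            \<xi> (ginv G h) * \<eta> (cmp G h g)
     else 0)"

text \<open>The ring has no unit in general; the field \<open>one\<close> is never used.\<close>

definition groupoid_ring :: "'g groupoid \<Rightarrow> ('g \<Rightarrow> int) ring"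
  where "groupoid_ring G =
    \<lparr>carrier = int_functions (arr_top G), mult = convolution G, one = undefined,
     ring.zero = (\<lambda>_. 0), add = (\<lambda>\<xi> \<eta> g. \<xi> g + \<eta> g)\<rparr>"


section \<open>Modules over rings without unit\<close>

text \<open>The locale \<open>module\<close> requires a commutative unital ring. Only its record type is used here, and
  the fields \<open>mult\<close> and \<open>one\<close> of a module record have no meaning.\<close>

definition action_span ::
    "('r, 'k) ring_scheme \<Rightarrow> ('r, 'm, 'l) module_scheme \<Rightarrow> 'm set"
  where "action_span R M =
    generate (add_monoid M) {a \<odot>\<^bsub>M\<^esub> x | a x. a \<in> carrier R \<and> x \<in> carrier M}"

definition nondegenerate_module ::
    "('r, 'k) ring_scheme \<Rightarrow> ('r, 'm, 'l) module_scheme \<Rightarrow> bool"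
  where "nondegenerate_module R M \<longleftrightarrow>
    abelian_group M
  \<and> (\<forall>a\<in>carrier R. \<forall>x\<in>carrier M. a \<odot>\<^bsub>M\<^esub> x \<in> carrier M)
  \<and> (\<forall>a\<in>carrier R. \<forall>b\<in>carrier R. \<forall>x\<in>carrier M.
       (a \<oplus>\<^bsub>R\<^esub> b) \<odot>\<^bsub>M\<^esub> x = a \<odot>\<^bsub>M\<^esub> x \<oplus>\<^bsub>M\<^esub> b \<odot>\<^bsub>M\<^esub> x)
  \<and> (\<forall>a\<in>carrier R. \<forall>x\<in>carrier M. \<forall>y\<in>carrier M.
       a \<odot>\<^bsub>M\<^esub> (x \<oplus>\<^bsub>M\<^esub> y) = a \<odot>\<^bsub>M\<^esub> x \<oplus>\<^bsub>M\<^esub> a \<odot>\<^bsub>M\<^esub> y)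
  \<and> (\<forall>a\<in>carrier R. \<forall>b\<in>carrier R. \<forall>x\<in>carrier M.
       (a \<otimes>\<^bsub>R\<^esub> b) \<odot>\<^bsub>M\<^esub> x = a \<odot>\<^bsub>M\<^esub> (b \<odot>\<^bsub>M\<^esub> x))
  \<and> action_span R M = carrier M"

definition module_maps ::
    "('r, 'k) ring_scheme \<Rightarrow> ('r, 'm, 'l) module_scheme \<Rightarrow> ('r, 'n, 'p) module_scheme
      \<Rightarrow> ('m \<Rightarrow> 'n) set"
  where "module_maps R M N = {f. f \<in> carrier M \<rightarrow> carrier N
    \<and> (\<forall>x\<in>carrier M. \<forall>y\<in>carrier M. f (x \<oplus>\<^bsub>M\<^esub> y) = f x \<oplus>\<^bsub>N\<^esub> f y)
    \<and> (\<forall>a\<in>carrier R. \<forall>x\<in>carrier M. f (a \<odot>\<^bsub>M\<^esub> x) = a \<odot>\<^bsub>N\<^esub> f x)}"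

abbreviation groupoid_module :: "'g groupoid \<Rightarrow> ('g \<Rightarrow> int, 'm) module \<Rightarrow> bool"
  where "groupoid_module G M \<equiv> nondegenerate_module (groupoid_ring G) M"

abbreviation groupoid_maps ::
    "'g groupoid \<Rightarrow> ('g \<Rightarrow> int, 'm) module \<Rightarrow> ('g \<Rightarrow> int, 'n) module \<Rightarrow> ('m \<Rightarrow> 'n) set"
  where "groupoid_maps G M N \<equiv> module_maps (groupoid_ring G) M N"


section \<open>Tensor products\<close>

text \<open>The tensor product over \<open>R\<close> of a right module \<open>A\<close>, with action \<open>\<rho>\<close>, and a left module \<open>N\<close> is the
  quotient of the free abelian group on \<open>carrier A \<times> carrier N\<close> by the balanced biadditivity relations.
  Its elements are cosets.\<close>

definition tensor_relators ::
    "('r, 'k) ring_scheme \<Rightarrow> ('a, 'l) ring_scheme \<Rightarrow> ('a \<Rightarrow> 'r \<Rightarrow> 'a) \<Rightarrow> ('r, 'n, 'p) module_scheme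
      \<Rightarrow> ('a \<times> 'n \<Rightarrow>\<^sub>0 int) set"
  where "tensor_relators R A \<rho> N =
    {frag_of (a \<oplus>\<^bsub>A\<^esub> b, x) - frag_of (a, x) - frag_of (b, x) | a b x.
       a \<in> carrier A \<and> b \<in> carrier A \<and> x \<in> carrier N}
  \<union> {frag_of (a, x \<oplus>\<^bsub>N\<^esub> y) - frag_of (a, x) - frag_of (a, y) | a x y.
       a \<in> carrier A \<and> x \<in> carrier N \<and> y \<in> carrier N}
  \<union> {frag_of (\<rho> a c, x) - frag_of (a, c \<odot>\<^bsub>N\<^esub> x) | a c x.
       a \<in> carrier A \<and> c \<in> carrier R \<and> x \<in> carrier N}"

definition tensor_null ::
    "('r, 'k) ring_scheme \<Rightarrow> ('a, 'l) ring_scheme \<Rightarrow> ('a \<Rightarrow> 'r \<Rightarrow> 'a) \<Rightarrow> ('r, 'n, 'p) module_scheme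
      \<Rightarrow> ('a \<times> 'n \<Rightarrow>\<^sub>0 int) set"
  where "tensor_null R A \<rho> N =
    generate (free_Abelian_group (carrier A \<times> carrier N)) (tensor_relators R A \<rho> N)"

definition tensor_group ::
    "('r, 'k) ring_scheme \<Rightarrow> ('a, 'l) ring_scheme \<Rightarrow> ('a \<Rightarrow> 'r \<Rightarrow> 'a) \<Rightarrow> ('r, 'n, 'p) module_scheme
      \<Rightarrow> ('a \<times> 'n \<Rightarrow>\<^sub>0 int) set monoid"
  where "tensor_group R A \<rho> N =
    free_Abelian_group (carrier A \<times> carrier N) Mod tensor_null R A \<rho> N"

definition tensor_coset ::
    "('r, 'k) ring_scheme \<Rightarrow> ('a, 'l) ring_scheme \<Rightarrow> ('a \<Rightarrow> 'r \<Rightarrow> 'a) \<Rightarrow> ('r, 'n, 'p) module_scheme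
      \<Rightarrow> ('a \<times> 'n \<Rightarrow>\<^sub>0 int) \<Rightarrow> ('a \<times> 'n \<Rightarrow>\<^sub>0 int) set"
  where "tensor_coset R A \<rho> N c =
    tensor_null R A \<rho> N #>\<^bsub>free_Abelian_group (carrier A \<times> carrier N)\<^esub> c"

text \<open>The map of cosets induced by a map \<open>\<phi>\<close> of generators, into the tensor product of \<open>A\<close> and \<open>N\<close>.
  When \<open>\<phi>\<close> respects the relations, the union is over a constant family.\<close>

definition tensor_map ::
    "('r, 'k) ring_scheme \<Rightarrow> ('a, 'l) ring_scheme \<Rightarrow> ('a \<Rightarrow> 'r \<Rightarrow> 'a) \<Rightarrow> ('r, 'n, 'p) module_scheme
      \<Rightarrow> ('b \<times> 'm \<Rightarrow> 'a \<times> 'n) \<Rightarrow> ('b \<times> 'm \<Rightarrow>\<^sub>0 int) set \<Rightarrow> ('a \<times> 'n \<Rightarrow>\<^sub>0 int) set"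
  where "tensor_map R A \<rho> N \<phi> X =
    (\<Union>c\<in>X. tensor_coset R A \<rho> N (frag_extend (\<lambda>p. frag_of (\<phi> p)) c))"


section \<open>Restriction and induction\<close>

text \<open>The carrier type of an induced module is built from that of the given module, so no single
  type holds the objects of both categories. Modules are therefore polymorphic in the carrier type,
  and both functors, the unit and the counit are polymorphic families indexed by all modules.
  A map of modules matters only on the carrier of its domain.\<close>

definition res_module ::
    "'g groupoid \<Rightarrow> ('g \<Rightarrow> int, 'n) module \<Rightarrow> ('g \<Rightarrow> int, 'n) module"
  where "res_module H N = N\<lparr>carrier := action_span (groupoid_ring H) N\<rparr>"

definition res_map ::
    "'g groupoid \<Rightarrow> ('g \<Rightarrow> int, 'n) module \<Rightarrow> ('n \<Rightarrow> 'n') \<Rightarrow> 'n \<Rightarrow> 'n'"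
  where "res_map H N f = restrict f (carrier (res_module H N))"

text \<open>The bimodule \<open>\<int>[G\<^bsub>H\<^sup>0\<^esub>]\<close>; both actions are convolution in \<open>G\<close>.\<close>

definition ind_bimodule :: "'g groupoid \<Rightarrow> 'g groupoid \<Rightarrow> ('g \<Rightarrow> int) ring"
  where "ind_bimodule G H = (groupoid_ring G)
    \<lparr>carrier := int_functions (subtopology (arr_top G) {g \<in> arrows G. src G g \<in> units H})\<rparr>"

type_synonym ('g, 'm) ind = "(('g \<Rightarrow> int) \<times> 'm \<Rightarrow>\<^sub>0 int) set"

definition ind_tensor ::
    "'g groupoid \<Rightarrow> 'g groupoid \<Rightarrow> ('g \<Rightarrow> int, 'm) module \<Rightarrow> ('g \<Rightarrow> int) \<Rightarrow> 'm \<Rightarrow> ('g, 'm) ind"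
  where "ind_tensor G H M \<xi> m =
    tensor_coset (groupoid_ring H) (ind_bimodule G H) (convolution G) M (frag_of (\<xi>, m))"

definition ind_module ::
    "'g groupoid \<Rightarrow> 'g groupoid \<Rightarrow> ('g \<Rightarrow> int, 'm) module \<Rightarrow> ('g \<Rightarrow> int, ('g, 'm) ind) module"
  where "ind_module G H M =
    (let T = tensor_group (groupoid_ring H) (ind_bimodule G H) (convolution G) M in
     \<lparr>carrier = carrier T, mult = undefined, one = undefined,
      ring.zero = \<one>\<^bsub>T\<^esub>, add = mult T,
      smult = (\<lambda>\<zeta>. tensor_map (groupoid_ring H) (ind_bimodule G H) (convolution G) M
                       (\<lambda>(\<xi>, m). (convolution G \<zeta> \<xi>, m)))\<rparr>)"

text \<open>\<open>ind_map G H M' f\<close> is the map \<open>id \<otimes> f\<close> induced by a map \<open>f\<close> of modules with codomain \<open>M'\<close>.\<close>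

definition ind_map ::
    "'g groupoid \<Rightarrow> 'g groupoid \<Rightarrow> ('g \<Rightarrow> int, 'm') module \<Rightarrow> ('m \<Rightarrow> 'm')
      \<Rightarrow> ('g, 'm) ind \<Rightarrow> ('g, 'm') ind"
  where "ind_map G H M' f =
    tensor_map (groupoid_ring H) (ind_bimodule G H) (convolution G) M' (\<lambda>(\<xi>, m). (\<xi>, f m))"


section \<open>Unit and counit\<close>

text \<open>As the ring of \<open>H\<close> is locally unital, every element of an \<open>H\<close>-module has the form \<open>\<zeta> \<odot> m\<close>.\<close>

definition ind_res_unit ::
    "'g groupoid \<Rightarrow> 'g groupoid \<Rightarrow> ('g \<Rightarrow> int, 'm) module \<Rightarrow> 'm \<Rightarrow> ('g, 'm) ind"
  where "ind_res_unit G H M x =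
    (THE t. \<exists>\<zeta>\<in>carrier (groupoid_ring H). \<exists>m\<in>carrier M.
       x = \<zeta> \<odot>\<^bsub>M\<^esub> m \<and> t = ind_tensor G H M \<zeta> m)"

text \<open>The sum \<open>\<Sum>k \<xi> \<odot> n\<close> over any formal combination \<open>\<Sum>k (\<xi>, n)\<close> representing the tensor.\<close>

definition ind_res_counit ::
    "'g groupoid \<Rightarrow> 'g groupoid \<Rightarrow> ('g \<Rightarrow> int, 'n) module \<Rightarrow> ('g, 'n) ind \<Rightarrow> 'n"
  where "ind_res_counit G H N t =
    (THE y. \<exists>c\<in>t. y = finsum N
       (\<lambda>(\<xi>, n). add_pow N (Poly_Mapping.lookup c (\<xi>, n)) (\<xi> \<odot>\<^bsub>N\<^esub> n)) (Poly_Mapping.keys c))"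

end

theory Submission
  imports Defs
begin

text \<open>
  The rings \<open>\<int>[H]\<close> and \<open>\<int>[G]\<close> and the bimodule between them consist of functions supported on an open set \<open>Y\<close> of
  arrows, namely \<open>H\<close>, \<open>G\<close> and \<open>G\<^bsub>H\<^sup>0\<^esub>\<close>. Each is spanned by the indicator functions of the compact open bisections
  inside \<open>Y\<close> (\<open>functions_on_eq_span\<close>). Indeed compact open bisections form a basis of the topology, because compact
  open sets form one of the unit space and \<open>src\<close> is a local homeomorphism; and inside a Hausdorff compact open set, a
  finite cover by compact open bisections can be made disjoint.

  For indicators, convolution is the product of sets of arrows: \<open>1\<^bsub>U\<^esub> * 1\<^bsub>V\<^esub> = 1\<^bsub>UV\<^esub>\<close> (\<open>convolution_indicator\<close>),
  and \<open>UV\<close> is again a compact open bisection. By bilinearity, associativity and all closure properties of the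
  rings and the bimodule reduce to evident facts about arrows. The indicator of a compact open set of units that contains
  the ranges of the supports is a left unit of given functions (\<open>functions_on_left_unit\<close>), and it can be taken in
  \<open>\<int>[H]\<close> if the functions lie there.

  The rest is algebra. Additive maps out of a tensor product are the same as balanced maps, and two of them agree if they
  agree on pure tensors. This gives the action of \<open>\<int>[G]\<close> on the induced module, the induced maps, and the counit
  \<open>\<xi> \<otimes> n \<mapsto> \<xi> \<odot> n\<close>. Because of the local units, every element \<open>x\<close> of an \<open>H\<close>-module is \<open>e \<odot> x\<close> for some \<open>e\<close> in
  \<open>\<int>[H]\<close>, and \<open>e \<otimes> x\<close> does not depend on the choice of \<open>e\<close>: a common left unit \<open>d\<close> of \<open>e\<close> and \<open>e'\<close> gives
  \<open>e \<otimes> x = d \<otimes> e \<odot> x = d \<otimes> e' \<odot> x = e' \<otimes> x\<close>. So \<open>x \<mapsto> e \<otimes> x\<close> defines the unit (\<open>ind_res_unit_tensor\<close>), and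
  the triangle identities are the computations \<open>\<xi> \<odot> (e \<otimes> m) = \<xi>e \<otimes> m = \<xi> \<otimes> e \<odot> m = \<xi> \<otimes> m\<close> if \<open>e \<odot> m = m\<close>, and
  \<open>e \<odot> n = n\<close>.
\<close>

section \<open>Algebra and topology of an ample groupoid\<close>

locale algebraic_groupoid =
  fixes G :: "'g groupoid"
  assumes laws: "groupoid_laws G"
begin

lemma src_arr [simp, intro]: "g \<in> arrows G \<Longrightarrow> src G g \<in> arrows G"
  and rng_arr [simp, intro]: "g \<in> arrows G \<Longrightarrow> rng G g \<in> arrows G"
  and src_src [simp]: "g \<in> arrows G \<Longrightarrow> src G (src G g) = src G g"
  and rng_src [simp]: "g \<in> arrows G \<Longrightarrow> rng G (src G g) = src G g"
  and src_rng [simp]: "g \<in> arrows G \<Longrightarrow> src G (rng G g) = rng G g"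
  and rng_rng [simp]: "g \<in> arrows G \<Longrightarrow> rng G (rng G g) = rng G g"
  and cmp_src [simp]: "g \<in> arrows G \<Longrightarrow> cmp G g (src G g) = g"
  and cmp_rng [simp]: "g \<in> arrows G \<Longrightarrow> cmp G (rng G g) g = g"
  and ginv_arr [simp, intro]: "g \<in> arrows G \<Longrightarrow> ginv G g \<in> arrows G"
  and src_ginv [simp]: "g \<in> arrows G \<Longrightarrow> src G (ginv G g) = rng G g"
  and rng_ginv [simp]: "g \<in> arrows G \<Longrightarrow> rng G (ginv G g) = src G g"
  and cmp_ginv [simp]: "g \<in> arrows G \<Longrightarrow> cmp G g (ginv G g) = rng G g"
  and ginv_cmp [simp]: "g \<in> arrows G \<Longrightarrow> cmp G (ginv G g) g = src G g"
  using laws unfolding groupoid_laws_def by blast+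

lemma cmp_arr [simp, intro]:
    "g \<in> arrows G \<Longrightarrow> h \<in> arrows G \<Longrightarrow> src G g = rng G h \<Longrightarrow> cmp G g h \<in> arrows G"
  and src_cmp [simp]:
    "g \<in> arrows G \<Longrightarrow> h \<in> arrows G \<Longrightarrow> src G g = rng G h \<Longrightarrow> src G (cmp G g h) = src G h"
  and rng_cmp [simp]:
    "g \<in> arrows G \<Longrightarrow> h \<in> arrows G \<Longrightarrow> src G g = rng G h \<Longrightarrow> rng G (cmp G g h) = rng G g"
  using laws unfolding groupoid_laws_def composable_def by auto

lemma cmp_assoc:
  assumes "g \<in> arrows G" "h \<in> arrows G" "k \<in> arrows G" "src G g = rng G h" "src G h = rng G k"
  shows "cmp G (cmp G g h) k = cmp G g (cmp G h k)"
  using laws assms unfolding groupoid_laws_def composable_def by auto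

lemma ginv_cancel_left:
  assumes "g \<in> arrows G" "h \<in> arrows G" "src G g = rng G h"
  shows "cmp G (ginv G g) (cmp G g h) = h"
  using cmp_assoc[of "ginv G g" g h] assms by simp

lemma cancel_ginv_left:
  assumes "g \<in> arrows G" "h \<in> arrows G" "rng G g = rng G h"
  shows "cmp G g (cmp G (ginv G g) h) = h"
  using cmp_assoc[of g "ginv G g" h] assms by simp

lemma ginv_ginv [simp]: "g \<in> arrows G \<Longrightarrow> ginv G (ginv G g) = g"
  using cancel_ginv_left[of g "ginv G (ginv G g)"] ginv_cancel_left[of "ginv G g" g]
  by (metis cmp_src ginv_arr ginv_cmp rng_ginv src_ginv)

lemma units_subset: "units G \<subseteq> arrows G"
  unfolding units_def by auto

lemma src_in_units [simp, intro]: "g \<in> arrows G \<Longrightarrow> src G g \<in> units G"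
  unfolding units_def by auto

lemma rng_in_units [simp, intro]: "g \<in> arrows G \<Longrightarrow> rng G g \<in> units G"
  unfolding units_def by (metis image_eqI rng_arr src_rng)

lemma unit_eqs [simp]:
  assumes "u \<in> units G"
  shows "u \<in> arrows G" "src G u = u" "rng G u = u" "ginv G u = u"
proof -
  show 1: "u \<in> arrows G" "src G u = u" "rng G u = u"
    using assms unfolding units_def by auto
  show "ginv G u = u"
    using 1 by (metis cmp_src ginv_arr ginv_cmp src_ginv)
qed

end

locale ample =
  fixes G :: "'g groupoid"
  assumes ample: "ample_groupoid G"

sublocale ample \<subseteq> algebraic_groupoid G
  using ample
  by unfold_locales (auto simp: ample_groupoid_def etale_groupoid_def topological_groupoid_def)

context ample
begin

lemma topspace_arr [simp]: "topspace (arr_top G) = arrows G"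
  by (simp add: arrows_def)

lemma openin_arr_subset: "openin (arr_top G) U \<Longrightarrow> U \<subseteq> arrows G"
  using openin_subset by fastforce

lemma topspace_unit_space [simp]: "topspace (unit_space G) = units G"
  using units_subset by (auto simp: unit_space_def)

lemma Hausdorff_unit_space: "Hausdorff_space (unit_space G)"
  using ample by (simp add: ample_groupoid_def)

lemma ginv_continuous: "continuous_map (arr_top G) (arr_top G) (ginv G)"
  using ample by (simp add: ample_groupoid_def etale_groupoid_def topological_groupoid_def)

lemma cmp_continuous:
  assumes "continuous_map X (arr_top G) a" "continuous_map X (arr_top G) b"
    and "\<And>x. x \<in> topspace X \<Longrightarrow> src G (a x) = rng G (b x)"
  shows "continuous_map X (arr_top G) (\<lambda>x. cmp G (a x) (b x))"
proof -
  have ar: "a x \<in> arrows G" "b x \<in> arrows G" if "x \<in> topspace X" for x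
    using assms that by (auto simp: continuous_map_def)
  have "continuous_map X (subtopology (prod_topology (arr_top G) (arr_top G)) (composable G))
      (\<lambda>x. (a x, b x))"
    using assms ar by (auto simp: continuous_map_in_subtopology continuous_map_pairedI composable_def)
  moreover have "continuous_map (subtopology (prod_topology (arr_top G) (arr_top G)) (composable G))
      (arr_top G) (\<lambda>(g, h). cmp G g h)"
    using ample by (simp add: ample_groupoid_def etale_groupoid_def topological_groupoid_def)
  ultimately have "continuous_map X (arr_top G) ((\<lambda>(g, h). cmp G g h) \<circ> (\<lambda>x. (a x, b x)))"
    by (rule continuous_map_compose)
  then show ?thesis by (simp add: o_def)
qed

end

lemma local_homeomorphism_continuous:
  assumes lh: "local_homeomorphism X Y f"
  shows "continuous_map X Y f"
proof (rule pasting_lemma[where f = "\<lambda>_. f" and T = id and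
      I = "{U. openin X U \<and> homeomorphic_map (subtopology X U) (subtopology Y (f ` U)) f}"])
  show "continuous_map (subtopology X (id U)) Y f"
    if "U \<in> {U. openin X U \<and> homeomorphic_map (subtopology X U) (subtopology Y (f ` U)) f}" for U
    using that homeomorphic_imp_continuous_map continuous_map_in_subtopology by fastforce
  show "\<exists>U. U \<in> {U. openin X U \<and> homeomorphic_map (subtopology X U) (subtopology Y (f ` U)) f}
      \<and> x \<in> id U \<and> f x = f x" if "x \<in> topspace X" for x
    using lh that unfolding local_homeomorphism_def by auto
qed auto

lemma local_homeomorphism_open:
  assumes lh: "local_homeomorphism X Y f"
  shows "open_map X Y f"
  unfolding open_map_def
proof (intro allI impI)
  fix W assume W: "openin X W"
  show "openin Y (f ` W)"
  proof (subst openin_subopen, clarify)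
    fix x assume x: "x \<in> W"
    then have "x \<in> topspace X" using W openin_subset by blast
    then obtain U where U: "x \<in> U" "openin X U" "openin Y (f ` U)"
      "homeomorphic_map (subtopology X U) (subtopology Y (f ` U)) f"
      using lh unfolding local_homeomorphism_def by metis
    have "openin (subtopology X U) (U \<inter> W)"
      using W by (auto simp: openin_subtopology)
    then have "openin (subtopology Y (f ` U)) (f ` (U \<inter> W))"
      using U(4) homeomorphic_imp_open_map open_map_def by blast
    then have "openin Y (f ` (U \<inter> W))"
      using U(3) openin_trans_full by blast
    then show "\<exists>T. openin Y T \<and> f x \<in> T \<and> T \<subseteq> f ` W"
      using x U(1) by (intro exI[of _ "f ` (U \<inter> W)"]) auto
  qed
qed

text \<open>In a compact Hausdorff space the component of a point is the intersection of the clopen sets around it.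
  In a compact neighbourhood \<open>K\<close> of \<open>x\<close> this intersection is \<open>{x}\<close>, so by compactness one clopen subset of
  \<open>K\<close> around \<open>x\<close> avoids the complement of a given open set. Taken inside the interior of \<open>K\<close>, it is open in
  the whole space.\<close>

lemma totally_disconnected_compact_open_base:
  assumes lc: "locally_compact_space X" and H: "Hausdorff_space X"
    and td: "totally_disconnected_space X" and W: "openin X W" "x \<in> W"
  shows "\<exists>K. openin X K \<and> compactin X K \<and> x \<in> K \<and> K \<subseteq> W"
proof -
  have xX: "x \<in> topspace X" using W openin_subset by blast
  obtain U K where UK: "openin X U" "compactin X K" "x \<in> U" "U \<subseteq> K"
    using lc xX unfolding locally_compact_space_def by blast
  define Y where "Y = subtopology X K"
  have top: "topspace Y = K"
    using UK(2) compactin_subset_topspace unfolding Y_def by fastforce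
  have Y: "compact_space Y" "Hausdorff_space Y"
    using UK(2) H by (auto simp: Y_def compact_space_subtopology Hausdorff_space_subtopology)
  have xK: "x \<in> K" using UK by auto
  have "connectedin X (connected_component_of_set Y x)"
    using connectedin_connected_component_of[of Y x] unfolding Y_def connectedin_subtopology by simp
  then obtain c where "connected_component_of_set Y x \<subseteq> {c}"
    using td unfolding totally_disconnected_space_def by blast
  then have "connected_component_of_set Y x \<subseteq> {x}"
    using xK top connected_component_of_refl[of Y x] by auto
  moreover have "quasi_component_of Y x = connected_component_of Y x"
    by (rule quasi_eq_connected_component_of) (use Y in simp)
  ultimately have q: "quasi_component_of_set Y x \<subseteq> {x}" by simp
  define C where "C = K - (W \<inter> U)"
  have "closedin Y C"
  proof -
    have "openin Y (K \<inter> (W \<inter> U))"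
      unfolding Y_def using W UK by (intro openin_subtopology_Int2) auto
    then have "closedin Y (topspace Y - K \<inter> (W \<inter> U))" by blast
    moreover have "topspace Y - K \<inter> (W \<inter> U) = C" using top by (auto simp: C_def)
    ultimately show ?thesis by simp
  qed
  then have "compactin Y C"
    using Y(1) closedin_compact_space by blast
  moreover have "disjnt (quasi_component_of_set Y x) C"
    using q W UK by (auto simp: C_def disjnt_def)
  ultimately have "separated_between Y (quasi_component_of_set Y x) C"
    using separated_between_quasi_component_compact xK top
    by (metis quasi_component_in_quasi_components_of)
  then obtain D E where D: "openin Y D" "openin Y E" "D \<union> E = K" "disjnt D E"
      "quasi_component_of_set Y x \<subseteq> D" "C \<subseteq> E"
    unfolding separated_between_def top by blast
  have xD: "x \<in> D" using D(5) xK top quasi_component_of_refl[of Y x] by auto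
  have sub: "D \<subseteq> W \<inter> U"
    using D by (auto simp: C_def disjnt_def)
  have "closedin Y D"
  proof -
    have "D = topspace Y - E" using D(3,4) top by (auto simp: disjnt_def)
    then show ?thesis using D(2) by blast
  qed
  then have "compactin X D"
    using Y closedin_compact_space compactin_subtopology unfolding Y_def by blast
  moreover have "openin X D"
  proof -
    obtain P where P: "openin X P" "D = P \<inter> K" using D(1) by (auto simp: Y_def openin_subtopology)
    then have "D = P \<inter> U" using sub UK by auto
    then show ?thesis using P UK by auto
  qed
  ultimately show ?thesis using xD sub by blast
qed

context ample
begin

lemma src_local_homeomorphism: "local_homeomorphism (arr_top G) (unit_space G) (src G)"
  and rng_local_homeomorphism: "local_homeomorphism (arr_top G) (unit_space G) (rng G)"
  using ample by (simp_all add: ample_groupoid_def etale_groupoid_def)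

lemmas src_continuous_unit = local_homeomorphism_continuous[OF src_local_homeomorphism]
  and rng_continuous_unit = local_homeomorphism_continuous[OF rng_local_homeomorphism]

lemma src_continuous: "continuous_map (arr_top G) (arr_top G) (src G)"
  and rng_continuous: "continuous_map (arr_top G) (arr_top G) (rng G)"
  using src_continuous_unit rng_continuous_unit
  by (auto simp: unit_space_def continuous_map_in_subtopology)

text \<open>Near a unit \<open>x\<close> the source map is injective. An arrow \<open>g\<close> so close to \<open>x\<close> that \<open>g\<close> and \<open>src G g\<close> both
  lie in the domain of injectivity has the same source as the unit \<open>src G g\<close>, hence equals it.\<close>

lemma open_units: "openin (arr_top G) (units G)"
proof (subst openin_subopen, clarify)
  fix x assume x: "x \<in> units G"
  then obtain U where U: "x \<in> U" "openin (arr_top G) U"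
      "homeomorphic_map (subtopology (arr_top G) U) (subtopology (unit_space G) (src G ` U)) (src G)"
    using src_local_homeomorphism unfolding local_homeomorphism_def by (metis topspace_arr unit_eqs(1))
  have inj: "inj_on (src G) U"
    using homeomorphic_imp_injective_map[OF U(3)] openin_arr_subset[OF U(2)] by (simp add: Int_absorb1)
  define V where "V = U \<inter> {g \<in> topspace (arr_top G). src G g \<in> U}"
  have "openin (arr_top G) V"
    unfolding V_def using U src_continuous openin_continuous_map_preimage by blast
  moreover have "x \<in> V" using x U by (auto simp: V_def)
  moreover have "V \<subseteq> units G"
  proof
    fix g assume "g \<in> V"
    then have g: "g \<in> U" "src G g \<in> U" "g \<in> arrows G" by (auto simp: V_def)
    then have "g = src G g" using inj by (simp add: inj_on_def)
    then show "g \<in> units G" using g by (metis src_in_units)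
  qed
  ultimately show "\<exists>T. openin (arr_top G) T \<and> x \<in> T \<and> T \<subseteq> units G" by blast
qed

lemma openin_unit_space_iff: "openin (unit_space G) U \<longleftrightarrow> openin (arr_top G) U \<and> U \<subseteq> units G"
  unfolding unit_space_def by (rule openin_open_subtopology[OF open_units])

lemma open_src_image: "openin (arr_top G) U \<Longrightarrow> openin (arr_top G) (src G ` U)"
  and open_rng_image: "openin (arr_top G) U \<Longrightarrow> openin (arr_top G) (rng G ` U)"
  using local_homeomorphism_open[OF src_local_homeomorphism]
    local_homeomorphism_open[OF rng_local_homeomorphism]
  by (simp_all add: open_map_def openin_unit_space_iff)

lemma src_homeomorphic_map:
  assumes U: "openin (arr_top G) U" and inj: "inj_on (src G) U"
  shows "homeomorphic_map (subtopology (arr_top G) U) (subtopology (arr_top G) (src G ` U)) (src G)"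
proof (rule bijective_open_imp_homeomorphic_map)
  have top: "topspace (subtopology (arr_top G) U) = U"
    using openin_arr_subset[OF U] by auto
  show "continuous_map (subtopology (arr_top G) U) (subtopology (arr_top G) (src G ` U)) (src G)"
    using top by (auto simp: continuous_map_in_subtopology src_continuous continuous_map_from_subtopology)
  show "open_map (subtopology (arr_top G) U) (subtopology (arr_top G) (src G ` U)) (src G)"
    unfolding open_map_def openin_open_subtopology[OF U] openin_open_subtopology[OF open_src_image[OF U]]
    using open_src_image by auto
  show "src G ` topspace (subtopology (arr_top G) U) = topspace (subtopology (arr_top G) (src G ` U))"
    using openin_arr_subset[OF open_src_image[OF U]] top by auto
  show "inj_on (src G) (topspace (subtopology (arr_top G) U))"
    using inj top by simp
qed

text \<open>A compact open bisection is automatically Hausdorff, as \<open>src G\<close> maps it injectively and continuously into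
  the unit space; hence its indicator function lies in the groupoid ring even if \<open>G\<close> is not Hausdorff.\<close>

definition compact_open_bisection :: "'g set \<Rightarrow> bool"
  where "compact_open_bisection B \<longleftrightarrow>
    openin (arr_top G) B \<and> compactin (arr_top G) B \<and> inj_on (src G) B \<and> inj_on (rng G) B"

text \<open>Compact open sets of units lift along the local homeomorphism \<open>src G\<close>.\<close>

lemma compact_open_bisection_base:
  assumes W: "openin (arr_top G) W" "g \<in> W"
  shows "\<exists>B. compact_open_bisection B \<and> g \<in> B \<and> B \<subseteq> W"
proof -
  have g: "g \<in> arrows G" using W openin_arr_subset by blast
  obtain U where U: "g \<in> U" "openin (arr_top G) U"
      "homeomorphic_map (subtopology (arr_top G) U) (subtopology (unit_space G) (src G ` U)) (src G)"
    using src_local_homeomorphism g unfolding local_homeomorphism_def by (metis topspace_arr)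
  obtain V where V: "g \<in> V" "openin (arr_top G) V"
      "homeomorphic_map (subtopology (arr_top G) V) (subtopology (unit_space G) (rng G ` V)) (rng G)"
    using rng_local_homeomorphism g unfolding local_homeomorphism_def by (metis topspace_arr)
  define P where "P = U \<inter> V \<inter> W"
  have P: "openin (arr_top G) P" "g \<in> P" using U V W by (auto simp: P_def)
  have injs: "inj_on (src G) P"
    using homeomorphic_imp_injective_map[OF U(3)] openin_arr_subset[OF U(2)]
    by (auto simp: Int_absorb1 P_def inj_on_def)
  have injr: "inj_on (rng G) P"
    using homeomorphic_imp_injective_map[OF V(3)] openin_arr_subset[OF V(2)]
    by (auto simp: Int_absorb1 P_def inj_on_def)
  have hom: "homeomorphic_map (subtopology (arr_top G) P) (subtopology (arr_top G) (src G ` P)) (src G)"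
    by (rule src_homeomorphic_map[OF P(1) injs])
  have "openin (unit_space G) (src G ` P)"
    using open_src_image[OF P(1)] openin_arr_subset[OF P(1)] by (auto simp: openin_unit_space_iff)
  then obtain K where K: "openin (unit_space G) K" "compactin (unit_space G) K" "src G g \<in> K"
      "K \<subseteq> src G ` P"
    using totally_disconnected_compact_open_base[of "unit_space G" "src G ` P" "src G g"] ample P(2)
    unfolding ample_groupoid_def by blast
  define B where "B = P \<inter> {h \<in> topspace (arr_top G). src G h \<in> K}"
  have sB: "src G ` B = K"
    using K(4) openin_arr_subset[OF P(1)] by (auto simp: B_def)
  have Bop: "openin (arr_top G) B"
    unfolding B_def using P(1) K(1) src_continuous openin_continuous_map_preimage
    by (fastforce simp: openin_unit_space_iff)
  have "compactin (subtopology (arr_top G) (src G ` P)) K"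
    using K(2,4) by (auto simp: compactin_subtopology unit_space_def)
  then have "compactin (subtopology (arr_top G) P) B"
    using homeomorphic_map_compactness[OF hom, of B] sB openin_arr_subset[OF P(1)]
    by (auto simp: B_def)
  then have "compactin (arr_top G) B" by (simp add: compactin_subtopology)
  moreover have "g \<in> B" using P K(3) g by (auto simp: B_def)
  moreover have "B \<subseteq> P" "P \<subseteq> W" by (auto simp: B_def P_def)
  moreover have "inj_on (src G) B" "inj_on (rng G) B"
    using injs injr \<open>B \<subseteq> P\<close> inj_on_subset by blast+
  ultimately show ?thesis
    using Bop unfolding compact_open_bisection_def by blast
qed

definition set_cmp :: "'g set \<Rightarrow> 'g set \<Rightarrow> 'g set"
  where "set_cmp U V = {cmp G u v | u v. u \<in> U \<and> v \<in> V \<and> src G u = rng G v}"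

text \<open>On an open set \<open>U\<close> where the source map is injective, its inverse depends continuously on the source.
  So multiplying \<open>g\<close> on the left by the only composable arrow of \<open>U\<close> is continuous in \<open>g\<close>.\<close>

lemma left_translation:
  assumes U: "openin (arr_top G) U" and inj: "inj_on (src G) U"
  obtains t where
    "continuous_map (subtopology (arr_top G) {g \<in> arrows G. rng G g \<in> src G ` U}) (arr_top G) t"
    "\<And>u g. u \<in> U \<Longrightarrow> g \<in> arrows G \<Longrightarrow> src G u = rng G g \<Longrightarrow> t g = cmp G u g"
proof -
  let ?D = "subtopology (arr_top G) {g \<in> arrows G. rng G g \<in> src G ` U}"
  obtain s where s: "homeomorphic_maps (subtopology (arr_top G) U)
      (subtopology (arr_top G) (src G ` U)) (src G) s"
    using src_homeomorphic_map[OF U inj] by (auto simp: homeomorphic_map_maps)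
  have UG: "U \<subseteq> arrows G" using U openin_arr_subset by blast
  have su: "s (src G u) = u" if "u \<in> U" for u
    using s that UG unfolding homeomorphic_maps_def by auto
  have "continuous_map ?D (subtopology (arr_top G) (src G ` U)) (rng G)"
    by (auto simp: continuous_map_in_subtopology continuous_map_from_subtopology rng_continuous)
  moreover have "continuous_map (subtopology (arr_top G) (src G ` U)) (arr_top G) s"
    using s unfolding homeomorphic_maps_def by (auto simp: continuous_map_in_subtopology)
  ultimately have "continuous_map ?D (arr_top G) (\<lambda>g. s (rng G g))"
    using continuous_map_compose[of ?D _ "rng G" "arr_top G" s] by (simp add: o_def)
  moreover have "continuous_map ?D (arr_top G) (\<lambda>g. g)"
    by (simp add: continuous_map_from_subtopology)
  ultimately have "continuous_map ?D (arr_top G) (\<lambda>g. cmp G (s (rng G g)) g)"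
    by (rule cmp_continuous) (auto simp: su)
  then show thesis
    by (rule that) (metis su)
qed

lemma open_ginv_image:
  assumes U: "openin (arr_top G) U"
  shows "openin (arr_top G) (ginv G ` U)"
proof -
  have "ginv G ` U = {g \<in> topspace (arr_top G). ginv G g \<in> U}"
    using openin_arr_subset[OF U] by (auto simp: image_iff) (metis ginv_ginv)
  then show ?thesis
    using openin_continuous_map_preimage[OF ginv_continuous U] by simp
qed

text \<open>Both topological claims come from left translations. The product is the preimage of \<open>V\<close> under translation
  by the inverses of arrows of \<open>U\<close>, hence open. It is also the image, under translation by \<open>U\<close>, of the arrows of
  \<open>V\<close> with range in \<open>src G ` U\<close>. The set \<open>src G ` U\<close> is compact, hence closed in the Hausdorff unit space,
  so these arrows form a closed subset of the compact set \<open>V\<close>.\<close>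

lemma compact_open_bisection_set_cmp:
  assumes U: "compact_open_bisection U" and V: "compact_open_bisection V"
  shows "compact_open_bisection (set_cmp U V)"
proof -
  have UG: "U \<subseteq> arrows G" and VG: "V \<subseteq> arrows G"
    using U V openin_arr_subset unfolding compact_open_bisection_def by auto
  have "openin (arr_top G) (set_cmp U V)"
  proof -
    have inj: "inj_on (src G) (ginv G ` U)"
      using U UG by (auto simp: inj_on_def compact_open_bisection_def subset_iff)
    have op: "openin (arr_top G) (ginv G ` U)"
      using U open_ginv_image by (auto simp: compact_open_bisection_def)
    have si: "src G ` ginv G ` U = rng G ` U"
      using UG by (force simp: image_iff subset_iff)
    let ?D = "{g \<in> arrows G. rng G g \<in> rng G ` U}"
    obtain t where t: "continuous_map (subtopology (arr_top G) ?D) (arr_top G) t"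
      "\<And>u g. u \<in> ginv G ` U \<Longrightarrow> g \<in> arrows G \<Longrightarrow> src G u = rng G g \<Longrightarrow> t g = cmp G u g"
      using left_translation[OF op inj] unfolding si by blast
    have D: "openin (arr_top G) ?D"
      using openin_continuous_map_preimage[OF rng_continuous open_rng_image[of U]] U
      by (simp add: compact_open_bisection_def)
    have "set_cmp U V = {g \<in> topspace (subtopology (arr_top G) ?D). t g \<in> V}"
    proof (intro subset_antisym subsetI)
      fix g assume "g \<in> set_cmp U V"
      then obtain u v where uv: "g = cmp G u v" "u \<in> U" "v \<in> V" "src G u = rng G v"
        by (auto simp: set_cmp_def)
      then have ar: "u \<in> arrows G" "v \<in> arrows G" using UG VG by auto
      have "t g = v"
        using t(2)[of "ginv G u" g] uv ar by (simp add: ginv_cancel_left)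
      then show "g \<in> {g \<in> topspace (subtopology (arr_top G) ?D). t g \<in> V}"
        using uv ar by auto
    next
      fix g assume "g \<in> {g \<in> topspace (subtopology (arr_top G) ?D). t g \<in> V}"
      then obtain u where g: "g \<in> arrows G" "u \<in> U" "rng G g = rng G u" "t g \<in> V" by auto
      then have ar: "u \<in> arrows G" using UG by auto
      then have tg: "t g = cmp G (ginv G u) g" using t(2)[of "ginv G u" g] g by simp
      then have "g = cmp G u (t g)" "src G u = rng G (t g)"
        using g ar by (simp_all add: cancel_ginv_left)
      then show "g \<in> set_cmp U V" using g by (auto simp: set_cmp_def)
    qed
    then have "openin (subtopology (arr_top G) ?D) (set_cmp U V)"
      using openin_continuous_map_preimage[OF t(1), of V] V by (simp add: compact_open_bisection_def)
    then show ?thesis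
      by (rule openin_trans_full[OF _ D])
  qed
  moreover have "compactin (arr_top G) (set_cmp U V)"
  proof -
    have op: "openin (arr_top G) U" and inj: "inj_on (src G) U"
      using U by (auto simp: compact_open_bisection_def)
    let ?D = "{g \<in> arrows G. rng G g \<in> src G ` U}"
    obtain t where t: "continuous_map (subtopology (arr_top G) ?D) (arr_top G) t"
      "\<And>u g. u \<in> U \<Longrightarrow> g \<in> arrows G \<Longrightarrow> src G u = rng G g \<Longrightarrow> t g = cmp G u g"
      using left_translation[OF op inj] by blast
    have "compactin (unit_space G) (src G ` U)"
      using U image_compactin[OF _ src_continuous_unit] by (auto simp: compact_open_bisection_def)
    then have "closedin (unit_space G) (src G ` U)"
      using Hausdorff_unit_space compactin_imp_closedin by blast
    then have "closedin (arr_top G) ?D"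
      using closedin_continuous_map_preimage[OF rng_continuous_unit] by simp
    then have "compactin (arr_top G) (?D \<inter> V)"
      using V closed_Int_compactin by (auto simp: compact_open_bisection_def)
    then have "compactin (subtopology (arr_top G) ?D) (?D \<inter> V)"
      by (simp add: compactin_subtopology)
    then have "compactin (arr_top G) (t ` (?D \<inter> V))"
      using image_compactin t(1) by blast
    moreover have "t ` (?D \<inter> V) = set_cmp U V"
    proof (intro subset_antisym subsetI)
      fix g assume "g \<in> t ` (?D \<inter> V)"
      then obtain u v where "g = t v" "v \<in> V" "u \<in> U" "src G u = rng G v" by auto
      moreover from this have "g = cmp G u v" using t(2)[of u v] VG by auto
      ultimately show "g \<in> set_cmp U V" unfolding set_cmp_def by blast
    next
      fix g assume "g \<in> set_cmp U V"
      then obtain u v where "g = cmp G u v" "u \<in> U" "v \<in> V" "src G u = rng G v"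
        by (auto simp: set_cmp_def)
      then have "g = t v" "v \<in> ?D \<inter> V" using t(2)[of u v] VG
        by (auto simp: image_iff intro: bexI[of _ u])
      then show "g \<in> t ` (?D \<inter> V)" by blast
    qed
    ultimately show ?thesis by simp
  qed
  moreover have "inj_on (src G) (set_cmp U V)" "inj_on (rng G) (set_cmp U V)"
  proof -
    have inj: "inj_on (src G) U" "inj_on (rng G) U" "inj_on (src G) V" "inj_on (rng G) V"
      using U V by (auto simp: compact_open_bisection_def)
    have "u = u' \<and> v = v'"
      if *: "u \<in> U" "u' \<in> U" "v \<in> V" "v' \<in> V" "src G u = rng G v" "src G u' = rng G v'"
        "src G (cmp G u v) = src G (cmp G u' v') \<or> rng G (cmp G u v) = rng G (cmp G u' v')"
      for u u' v v'
    proof -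
      have ar: "u \<in> arrows G" "u' \<in> arrows G" "v \<in> arrows G" "v' \<in> arrows G"
        using * UG VG by auto
      from *(7) have "src G v = src G v' \<or> rng G u = rng G u'" using ar * by simp
      then have "v = v' \<or> u = u'" using inj(2,3) * by (meson inj_onD)
      then show ?thesis using inj(1,4) *(1-6) by (metis inj_onD)
    qed
    note eq = this
    show "inj_on (src G) (set_cmp U V)" "inj_on (rng G) (set_cmp U V)"
      by (rule inj_onI; clarsimp simp: set_cmp_def; frule (5) eq; simp)+
  qed
  ultimately show ?thesis by (simp add: compact_open_bisection_def)
qed

end

section \<open>Functions spanned by compact open bisections\<close>

lemma carrier_pointwise_group [simp]: "carrier pointwise_group = UNIV"
  and mult_pointwise_group [simp]: "f \<otimes>\<^bsub>pointwise_group\<^esub> g = (\<lambda>x. f x + g x)"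
  and one_pointwise_group [simp]: "\<one>\<^bsub>pointwise_group\<^esub> = (\<lambda>_. 0)"
  by (simp_all add: pointwise_group_def)

lemma group_pointwise_group: "group pointwise_group"
proof (rule groupI)
  show "\<exists>g\<in>carrier pointwise_group. g \<otimes>\<^bsub>pointwise_group\<^esub> f = \<one>\<^bsub>pointwise_group\<^esub>" for f :: "'x \<Rightarrow> int"
    by (rule bexI[of _ "\<lambda>x. - f x"]) auto
qed (auto simp: add.assoc)

lemma inv_pointwise_group [simp]: "inv\<^bsub>pointwise_group\<^esub> f = (\<lambda>x. - f x)"
  by (rule group.inv_equality[OF group_pointwise_group]) auto

lemma subgroup_generate_pointwise_group: "subgroup (generate pointwise_group S) pointwise_group"
  by (rule group.generate_is_subgroup[OF group_pointwise_group]) simp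

lemma pointwise_subgroup:
  assumes "subgroup S pointwise_group"
  shows "(\<lambda>_. 0) \<in> S"
    and "f \<in> S \<Longrightarrow> g \<in> S \<Longrightarrow> (\<lambda>x. f x + g x) \<in> S"
    and "f \<in> S \<Longrightarrow> g \<in> S \<Longrightarrow> (\<lambda>x. f x - g x) \<in> S"
    and "f \<in> S \<Longrightarrow> (\<lambda>x. n * f x) \<in> S"
    and "finite A \<Longrightarrow> (\<And>a. a \<in> A \<Longrightarrow> F a \<in> S) \<Longrightarrow> (\<lambda>x. \<Sum>a\<in>A. F a x) \<in> S"
proof -
  show 0: "(\<lambda>_. 0) \<in> S"
    using subgroup.one_closed[OF assms] by simp
  show add: "(\<lambda>x. f x + g x) \<in> S" if "f \<in> S" "g \<in> S" for f g
    using subgroup.m_closed[OF assms that] by simp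
  show diff: "(\<lambda>x. f x - g x) \<in> S" if "f \<in> S" "g \<in> S" for f g
    using add[OF that(1) subgroup.m_inv_closed[OF assms that(2)]] by simp
  show "(\<lambda>x. n * f x) \<in> S" if "f \<in> S"
  proof (induction n rule: int_induct[where k = 0])
    case (step1 i)
    then show ?case using add[OF _ that, of "\<lambda>x. i * f x"] by (simp add: algebra_simps)
  next
    case (step2 i)
    then show ?case using diff[OF _ that, of "\<lambda>x. i * f x"] by (simp add: algebra_simps)
  qed (simp add: 0)
  show "finite A \<Longrightarrow> (\<And>a. a \<in> A \<Longrightarrow> F a \<in> S) \<Longrightarrow> (\<lambda>x. \<Sum>a\<in>A. F a x) \<in> S"
  proof (induction A rule: finite_induct)
    case (insert a A)
    then show ?case using add[of "F a" "\<lambda>x. \<Sum>a\<in>A. F a x"] by simp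
  qed (simp add: 0)
qed

lemma subgroup_int_functions: "subgroup (int_functions X) pointwise_group"
  unfolding int_functions_def by (rule subgroup_generate_pointwise_group)

lemma cc_int_open_subspace:
  assumes "U \<subseteq> Y"
  shows "cc_int (subtopology X Y) U = cc_int X U"
  using assms by (simp add: cc_int_def subtopology_subtopology inf.absorb2)

lemma cc_int_indicator:
  assumes B: "openin X B" "compactin X B"
  shows "indicator B \<in> cc_int X B"
proof -
  have BX: "B \<subseteq> topspace X" using B openin_subset by blast
  have eq: "{x \<in> B. (indicator B x :: int) \<noteq> 0} = B" by (auto simp: indicator_def)
  have "continuous_map (subtopology X B) (discrete_topology UNIV) (\<lambda>_. 1 :: int)"
    by simp
  then have "continuous_map (subtopology X B) (discrete_topology UNIV) (indicator B :: _ \<Rightarrow> int)"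
    by (rule continuous_map_eq) simp
  moreover have "subtopology X B closure_of B = B"
    using closure_of_topspace[of "subtopology X B"] BX by (simp add: Int_absorb1)
  ultimately show ?thesis
    using B unfolding cc_int_def mem_Collect_eq eq by (simp add: compactin_subtopology)
qed

text \<open>The support of \<open>f\<close> is closed in \<open>U\<close>, so it equals its closure and is compact; \<open>f\<close> maps it to a compact,
  that is finite, set of integers.\<close>

lemma cc_int_level_sets:
  assumes U: "openin X U" and f: "f \<in> cc_int X U"
  shows "finite (f ` {x \<in> U. f x \<noteq> 0})"
    and "n \<noteq> 0 \<Longrightarrow> openin X {x \<in> U. f x = n}"
    and "n \<noteq> 0 \<Longrightarrow> compactin X {x \<in> U. f x = n}"
proof -
  have UX: "U \<subseteq> topspace X" using U openin_subset by blast
  have cont: "continuous_map (subtopology X U) (discrete_topology UNIV) f"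
    and com: "compactin (subtopology X U) (subtopology X U closure_of {x \<in> U. f x \<noteq> 0})"
    using f by (auto simp: cc_int_def)
  have top: "topspace (subtopology X U) = U" using UX by auto
  have clopen: "openin (subtopology X U) {x \<in> U. f x \<in> A}" "closedin (subtopology X U) {x \<in> U. f x \<in> A}"
    for A
    using openin_continuous_map_preimage[OF cont, of A] closedin_continuous_map_preimage[OF cont, of A]
    unfolding top by simp_all
  have "compactin (subtopology X U) {x \<in> U. f x \<noteq> 0}"
    using com clopen(2)[of "- {0}"] by (simp add: closure_of_closedin)
  then show "finite (f ` {x \<in> U. f x \<noteq> 0})"
    using image_compactin[OF _ cont] by (simp add: compactin_discrete_topology)
  show "openin X {x \<in> U. f x = n}" if "n \<noteq> 0"
    using clopen(1)[of "{n}"] openin_trans_full[OF _ U] by simp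
  show "compactin X {x \<in> U. f x = n}" if "n \<noteq> 0"
  proof -
    have "compactin (subtopology X U) {x \<in> U. f x = n}"
      using closed_compactin[OF \<open>compactin (subtopology X U) {x \<in> U. f x \<noteq> 0}\<close> _ clopen(2)[of "{n}"]] that
      by auto
    then show ?thesis by (simp add: compactin_subtopology)
  qed
qed

context ample
begin

abbreviation functions_on :: "'g set \<Rightarrow> ('g \<Rightarrow> int) set"
  where "functions_on Y \<equiv> int_functions (subtopology (arr_top G) Y)"

lemma functions_on_arrows: "functions_on (arrows G) = int_functions (arr_top G)"
  using subtopology_topspace[of "arr_top G"] by simp

lemma Hausdorff_bisection:
  assumes "openin (arr_top G) B" "inj_on (src G) B"
  shows "Hausdorff_space (subtopology (arr_top G) B)"
  using Hausdorff_space_injective_preimage[OF Hausdorff_unit_space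
      continuous_map_from_subtopology[OF src_continuous_unit]] openin_arr_subset[OF assms(1)] assms(2)
  by (simp add: Int_absorb1)

text \<open>A finite cover of \<open>K\<close> by bisections is made disjoint one member at a time. This is where \<open>K\<close> must be
  Hausdorff: a compact open subset of \<open>K\<close> is closed in \<open>K\<close>, so removing it from a bisection leaves a compact
  open bisection.\<close>

lemma indicator_compact_open_Hausdorff:
  assumes K: "openin (arr_top G) K" "compactin (arr_top G) K"
    and H: "Hausdorff_space (subtopology (arr_top G) K)" and KY: "K \<subseteq> Y"
  shows "indicator K \<in> generate pointwise_group {indicator B | B. compact_open_bisection B \<and> B \<subseteq> Y}"
    (is "_ \<in> ?S")
proof -
  note S = pointwise_subgroup[OF subgroup_generate_pointwise_group]
  have fin: "indicator (\<Union>F) \<in> ?S"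
    if "finite F" "\<And>B. B \<in> F \<Longrightarrow> compact_open_bisection B \<and> B \<subseteq> K" for F
    using that
  proof (induction F rule: finite_induct)
    case empty
    then show ?case using S(1) by (simp add: indicator_def[abs_def])
  next
    case (insert B F)
    let ?D = "B - \<Union>F"
    have B: "openin (arr_top G) B" "compactin (arr_top G) B" "B \<subseteq> K"
      and inj: "inj_on (src G) B" "inj_on (rng G) B"
      using insert.prems by (auto simp: compact_open_bisection_def)
    have FK: "\<Union>F \<subseteq> K" using insert.prems by auto
    have opF: "openin (arr_top G) (\<Union>F)"
      using insert.prems by (auto simp: compact_open_bisection_def)
    have "compactin (arr_top G) (\<Union>F)"
      using insert.prems insert.hyps by (intro compactin_Union) (auto simp: compact_open_bisection_def)
    then have "closedin (subtopology (arr_top G) K) (\<Union>F)"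
      using H FK by (intro compactin_imp_closedin) (auto simp: compactin_subtopology)
    moreover have "openin (subtopology (arr_top G) K) B"
      using B K by (simp add: openin_open_subtopology)
    ultimately have "openin (subtopology (arr_top G) K) ?D" by blast
    then have opD: "openin (arr_top G) ?D" using K by (simp add: openin_open_subtopology)
    have "openin (subtopology (arr_top G) K) (\<Union>F)"
      using opF FK K(1) by (simp add: openin_open_subtopology)
    then have "closedin (subtopology (arr_top G) K) (K - \<Union>F)"
      using openin_arr_subset[OF K(1)] by (metis closedin_topspace openin_closedin_eq closedin_diff
          topspace_subtopology_subset topspace_arr openin_subset)
    then have "compactin (subtopology (arr_top G) K) ((K - \<Union>F) \<inter> B)"
      using B by (intro closed_Int_compactin) (auto simp: compactin_subtopology)
    moreover have "(K - \<Union>F) \<inter> B = ?D" using B by auto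
    ultimately have "compact_open_bisection ?D"
      using opD inj by (auto simp: compact_open_bisection_def compactin_subtopology inj_on_def)
    then have "indicator ?D \<in> ?S"
      using B KY by (intro generate.incl) auto
    moreover have "indicator (\<Union>F) \<in> ?S"
      by (rule insert.IH) (use insert.prems in auto)
    ultimately have "(\<lambda>x. indicator ?D x + indicator (\<Union>F) x) \<in> ?S" by (rule S(2))
    moreover have "(\<lambda>x. indicator ?D x + indicator (\<Union>F) x) = (indicator (\<Union>(insert B F)) :: _ \<Rightarrow> int)"
      by (auto simp: indicator_def)
    ultimately show ?case by simp
  qed
  let ?C = "{B. compact_open_bisection B \<and> B \<subseteq> K}"
  have "\<exists>F. finite F \<and> F \<subseteq> ?C \<and> K \<subseteq> \<Union>F"
  proof (rule compactinD[OF K(2)])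
    show "K \<subseteq> \<Union>?C" using compact_open_bisection_base[OF K(1)] by blast
  qed (auto simp: compact_open_bisection_def)
  then obtain F where F: "finite F" "F \<subseteq> ?C" "K \<subseteq> \<Union>F" by blast
  then have "\<Union>F = K" by auto
  then show ?thesis using fin[of F] F by auto
qed

text \<open>A function in some \<open>cc_int\<close> is the finite sum of its nonzero values times the indicators of the level sets,
  which are compact open and Hausdorff.\<close>

theorem functions_on_eq_span:
  assumes Y: "openin (arr_top G) Y"
  shows "functions_on Y = generate pointwise_group {indicator B | B. compact_open_bisection B \<and> B \<subseteq> Y}"
    (is "_ = ?S")
proof
  note S = pointwise_subgroup[OF subgroup_generate_pointwise_group]
  let ?gen = "\<Union>U\<in>{U. openin (subtopology (arr_top G) Y) U
    \<and> Hausdorff_space (subtopology (subtopology (arr_top G) Y) U)}. cc_int (subtopology (arr_top G) Y) U"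
  have "?gen \<subseteq> ?S"
  proof clarify
    fix U f assume U: "openin (subtopology (arr_top G) Y) U"
      "Hausdorff_space (subtopology (subtopology (arr_top G) Y) U)"
      and f: "f \<in> cc_int (subtopology (arr_top G) Y) U"
    have UY: "U \<subseteq> Y" and Uop: "openin (arr_top G) U"
      using U(1) Y by (auto simp: openin_open_subtopology)
    have H: "Hausdorff_space (subtopology (arr_top G) U)"
      using U(2) UY by (simp add: subtopology_subtopology inf.absorb2)
    have f': "f \<in> cc_int (arr_top G) U" using f UY by (simp add: cc_int_open_subspace)
    note level = cc_int_level_sets[OF Uop f']
    let ?N = "f ` {x \<in> U. f x \<noteq> 0}"
    have "(\<lambda>x. \<Sum>n\<in>?N. n * indicator {x \<in> U. f x = n} x) \<in> ?S"
    proof (intro S(5) S(4) level(1))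
      fix n assume "n \<in> ?N"
      then have n: "n \<noteq> 0" by auto
      have "Hausdorff_space (subtopology (arr_top G) {x \<in> U. f x = n})"
        using Hausdorff_space_subtopology[OF H, of "{x \<in> U. f x = n}"]
        by (simp add: subtopology_subtopology Int_absorb1)
      then show "indicator {x \<in> U. f x = n} \<in> ?S"
        using level(2,3)[OF n] UY by (intro indicator_compact_open_Hausdorff) auto
    qed
    moreover have "(\<Sum>n\<in>?N. n * indicator {x \<in> U. f x = n} x) = f x" for x
    proof (cases "x \<in> U \<and> f x \<noteq> 0")
      case True
      then have "(\<Sum>n\<in>?N. n * indicator {x \<in> U. f x = n} x) = (\<Sum>n\<in>?N. if n = f x then f x else 0)"
        by (intro sum.cong) (auto simp: indicator_def)
      then show ?thesis using True level(1) by (simp add: sum.delta)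
    next
      case False
      then have "f x = 0" using f' by (auto simp: cc_int_def)
      then show ?thesis by (auto simp: indicator_def intro!: sum.neutral)
    qed
    ultimately show "f \<in> ?S" by simp
  qed
  then show "functions_on Y \<subseteq> ?S"
    unfolding int_functions_def
    by (rule group.generate_subgroup_incl[OF group_pointwise_group _ subgroup_generate_pointwise_group])
  have "{indicator B | B. compact_open_bisection B \<and> B \<subseteq> Y} \<subseteq> ?gen"
  proof clarify
    fix B assume B: "compact_open_bisection B" "B \<subseteq> Y"
    then have "openin (subtopology (arr_top G) Y) B"
      "Hausdorff_space (subtopology (subtopology (arr_top G) Y) B)"
      "indicator B \<in> cc_int (subtopology (arr_top G) Y) B"
      using Y Hausdorff_bisection[of B]
      by (auto simp: openin_open_subtopology compact_open_bisection_def subtopology_subtopology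
          inf.absorb2 cc_int_open_subspace intro!: cc_int_indicator)
    then show "indicator B \<in> ?gen" by blast
  qed
  then show "?S \<subseteq> functions_on Y"
    unfolding int_functions_def by (rule group.mono_generate[OF group_pointwise_group])
qed

lemma indicator_in_functions_on:
  assumes "openin (arr_top G) Y" "compact_open_bisection B" "B \<subseteq> Y"
  shows "indicator B \<in> functions_on Y"
  unfolding functions_on_eq_span[OF assms(1)] using assms(2,3) by (auto intro: generate.incl)

text \<open>Closure under differences suffices: the zero function is the indicator of the empty bisection.\<close>

lemma functions_on_induct [consumes 2, case_names bisection diff]:
  assumes Y: "openin (arr_top G) Y" and f: "f \<in> functions_on Y"
    and bis: "\<And>B. compact_open_bisection B \<Longrightarrow> B \<subseteq> Y \<Longrightarrow> P (indicator B)"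
    and diff: "\<And>f g. f \<in> functions_on Y \<Longrightarrow> g \<in> functions_on Y \<Longrightarrow> P f \<Longrightarrow> P g \<Longrightarrow> P (\<lambda>x. f x - g x)"
  shows "P f"
proof -
  note F = pointwise_subgroup[OF subgroup_int_functions]
  have 0: "P (\<lambda>_. 0)"
  proof -
    have "compact_open_bisection {}" by (simp add: compact_open_bisection_def)
    then have "P (indicator {})" by (rule bis) simp
    then show ?thesis by (simp add: indicator_def[abs_def])
  qed
  have "f \<in> functions_on Y \<and> P f"
    using f unfolding functions_on_eq_span[OF Y]
  proof (induction rule: generate.induct)
    case one
    then show ?case using 0 by (auto intro: generate.one[of pointwise_group, simplified])
  next
    case (incl h)
    then show ?case using bis by (auto intro: generate.incl)
  next
    case (inv h)
    then have "h \<in> functions_on Y" "P h"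
      using bis indicator_in_functions_on[OF Y] by auto
    then have "P (\<lambda>x. - h x)" "(\<lambda>x. - h x) \<in> functions_on Y"
      using diff[OF F(1) _ 0, of h] F(3)[OF F(1), of h] by simp_all
    then show ?case using functions_on_eq_span[OF Y] by simp
  next
    case (eng h1 h2)
    then have h: "h1 \<in> functions_on Y" "P h1" "h2 \<in> functions_on Y" "P h2"
      using functions_on_eq_span[OF Y] by auto
    have "P (\<lambda>x. h1 x - (0 - h2 x))"
      using h diff[OF F(1) h(3) 0 h(4)] F(3)[OF F(1) h(3)] diff by blast
    moreover have "(\<lambda>x. h1 x + h2 x) \<in> functions_on Y"
      using h F(2) by blast
    ultimately show ?case using functions_on_eq_span[OF Y] by simp
  qed
  then show ?thesis ..
qed

end

section \<open>Convolution and local units\<close>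

context ample
begin

lemma compact_open_bisection_units:
  assumes "openin (arr_top G) K" "compactin (arr_top G) K" "K \<subseteq> units G"
  shows "compact_open_bisection K"
proof -
  have "inj_on (src G) K" "inj_on (rng G) K"
    using assms(3) unit_eqs(2,3) by (metis inj_onI subsetD)+
  then show ?thesis using assms(1,2) by (simp add: compact_open_bisection_def)
qed

lemma compact_open_bisection_Un_units:
  assumes "compact_open_bisection K" "compact_open_bisection L" "K \<union> L \<subseteq> units G"
  shows "compact_open_bisection (K \<union> L)"
  using assms by (intro compact_open_bisection_units)
    (simp_all add: compact_open_bisection_def openin_Un compactin_Un)

text \<open>The set \<open>K\<close> is a compact open set of units, the union of the ranges of the bisections that occur. Its
  indicator will be a left unit for \<open>f\<close>.\<close>

lemma functions_on_support:
  assumes Y: "openin (arr_top G) Y" and f: "f \<in> functions_on Y"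
  obtains K where "compact_open_bisection K" "K \<subseteq> rng G ` Y"
    "\<And>g. f g \<noteq> 0 \<Longrightarrow> g \<in> Y \<and> rng G g \<in> K"
proof -
  have "\<exists>K. compact_open_bisection K \<and> K \<subseteq> rng G ` Y \<and> (\<forall>g. f g \<noteq> 0 \<longrightarrow> g \<in> Y \<and> rng G g \<in> K)"
    using Y f
  proof (induction rule: functions_on_induct)
    case (bisection B)
    have "compact_open_bisection (rng G ` B)"
    proof (rule compact_open_bisection_units)
      have B: "openin (arr_top G) B" "compactin (arr_top G) B" "B \<subseteq> arrows G"
        using bisection openin_arr_subset by (auto simp: compact_open_bisection_def)
      show "openin (arr_top G) (rng G ` B)" using B open_rng_image by blast
      show "compactin (arr_top G) (rng G ` B)" using B image_compactin rng_continuous by blast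
      show "rng G ` B \<subseteq> units G" using B(3) by auto
    qed
    moreover have "rng G ` B \<subseteq> rng G ` Y" using bisection by blast
    ultimately show ?case using bisection by (intro exI[of _ "rng G ` B"]) (auto simp: indicator_def)
  next
    case (diff f g)
    obtain K L where K: "compact_open_bisection K" "K \<subseteq> rng G ` Y"
        "\<And>h. f h \<noteq> 0 \<Longrightarrow> h \<in> Y \<and> rng G h \<in> K"
      and L: "compact_open_bisection L" "L \<subseteq> rng G ` Y"
        "\<And>h. g h \<noteq> 0 \<Longrightarrow> h \<in> Y \<and> rng G h \<in> L"
      using diff by blast
    have sub: "K \<union> L \<subseteq> units G" using K(2) L(2) openin_arr_subset[OF Y] by auto
    have "compact_open_bisection (K \<union> L)"
      using K(1) L(1) sub by (rule compact_open_bisection_Un_units)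
    moreover have "f h - g h \<noteq> 0 \<Longrightarrow> f h \<noteq> 0 \<or> g h \<noteq> 0" for h by auto
    ultimately show ?case using K L by (intro exI[of _ "K \<union> L"]) blast
  qed
  then show thesis using that by blast
qed

lemma functions_on_zero_outside:
  assumes "openin (arr_top G) Y" "f \<in> functions_on Y" "g \<notin> Y"
  shows "f g = 0"
  using functions_on_support[OF assms(1,2)] assms(3) by metis

lemma functions_on_mono:
  assumes "openin (arr_top G) Y" "openin (arr_top G) Z" "Y \<subseteq> Z"
  shows "functions_on Y \<subseteq> functions_on Z"
  unfolding functions_on_eq_span[OF assms(1)] functions_on_eq_span[OF assms(2)]
  using assms(3) by (intro group.mono_generate[OF group_pointwise_group]) auto

lemma finite_range_fibre:
  assumes "openin (arr_top G) Y" "f \<in> functions_on Y"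
  shows "finite {k. f k \<noteq> 0 \<and> rng G k = x}"
  using assms
proof (induction rule: functions_on_induct)
  case (bisection B)
  have sub: "{k. (indicator B k :: int) \<noteq> 0 \<and> rng G k = x} \<subseteq> {k \<in> B. rng G k = x}"
    by (auto simp: indicator_def)
  have "inj_on (rng G) {k \<in> B. rng G k = x}"
    using bisection by (auto simp: compact_open_bisection_def inj_on_def)
  moreover have "rng G ` {k \<in> B. rng G k = x} \<subseteq> {x}" by auto
  ultimately have "finite {k \<in> B. rng G k = x}"
    using finite_imageD finite_subset by blast
  then show ?case using sub finite_subset by blast
next
  case (diff f g)
  have "{k. f k - g k \<noteq> 0 \<and> rng G k = x} \<subseteq> {k. f k \<noteq> 0 \<and> rng G k = x} \<union> {k. g k \<noteq> 0 \<and> rng G k = x}"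
    by auto
  then show ?case using diff finite_subset by blast
qed

text \<open>Reindexing by inverses turns the sum over a source fibre into one over the range fibre of \<open>\<xi>\<close>. The
  bound \<open>F\<close> is arbitrary so that convolutions with several functions can be computed over the same finite set, which
  makes them additive.\<close>

lemma convolution_eq_sum:
  assumes g: "g \<in> arrows G" and F: "finite F" "F \<subseteq> {k \<in> arrows G. rng G k = rng G g}"
    and supp: "\<And>k. k \<in> arrows G \<Longrightarrow> rng G k = rng G g \<Longrightarrow> \<xi> k \<noteq> 0 \<Longrightarrow> k \<in> F"
  shows "convolution G \<xi> \<eta> g = (\<Sum>k\<in>F. \<xi> k * \<eta> (cmp G (ginv G k) g))"
proof -
  let ?S = "{h. h \<in> arrows G \<and> src G h = rng G g \<and> \<xi> (ginv G h) * \<eta> (cmp G h g) \<noteq> 0}"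
  have FG: "k \<in> arrows G" "rng G k = rng G g" if "k \<in> F" for k using F that by auto
  have inj: "inj_on (ginv G) F"
    by (rule inj_on_inverseI[of _ "ginv G"]) (simp add: FG)
  have "?S \<subseteq> ginv G ` F"
  proof
    fix h assume "h \<in> ?S"
    then have h: "h \<in> arrows G" "src G h = rng G g" "\<xi> (ginv G h) \<noteq> 0" by auto
    then have "ginv G h \<in> F" using supp[of "ginv G h"] by simp
    then show "h \<in> ginv G ` F" using h by (intro image_eqI[of _ _ "ginv G h"]) simp_all
  qed
  then have "(\<Sum>h\<in>?S. \<xi> (ginv G h) * \<eta> (cmp G h g)) = (\<Sum>h\<in>ginv G ` F. \<xi> (ginv G h) * \<eta> (cmp G h g))"
    using F(1) FG by (intro sum.mono_neutral_left) auto
  also have "\<dots> = (\<Sum>k\<in>F. \<xi> k * \<eta> (cmp G (ginv G k) g))"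
    using FG by (simp add: sum.reindex[OF inj])
  finally show ?thesis using g by (simp add: convolution_def)
qed

lemma convolution_outside: "g \<notin> arrows G \<Longrightarrow> convolution G \<xi> \<eta> g = 0"
  by (simp add: convolution_def)

lemma convolution_linear_left:
  assumes Y: "openin (arr_top G) Y" and \<xi>: "\<xi> \<in> functions_on Y" "\<xi>' \<in> functions_on Y"
  shows "convolution G (\<lambda>x. \<xi> x + \<xi>' x) \<eta> = (\<lambda>x. convolution G \<xi> \<eta> x + convolution G \<xi>' \<eta> x)"
    and "convolution G (\<lambda>x. \<xi> x - \<xi>' x) \<eta> = (\<lambda>x. convolution G \<xi> \<eta> x - convolution G \<xi>' \<eta> x)"
proof -
  have "convolution G (\<lambda>x. \<xi> x + \<xi>' x) \<eta> g = convolution G \<xi> \<eta> g + convolution G \<xi>' \<eta> g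
    \<and> convolution G (\<lambda>x. \<xi> x - \<xi>' x) \<eta> g = convolution G \<xi> \<eta> g - convolution G \<xi>' \<eta> g" for g
  proof (cases "g \<in> arrows G")
    case True
    define F where "F = {k. \<xi> k \<noteq> 0 \<and> rng G k = rng G g} \<union> {k. \<xi>' k \<noteq> 0 \<and> rng G k = rng G g}"
    have fin: "finite F"
      unfolding F_def using finite_range_fibre[OF Y] \<xi> by blast
    have sub: "F \<subseteq> {k \<in> arrows G. rng G k = rng G g}"
      using functions_on_zero_outside[OF Y] \<xi> openin_arr_subset[OF Y] unfolding F_def by blast
    have "convolution G \<zeta> \<eta> g = (\<Sum>k\<in>F. \<zeta> k * \<eta> (cmp G (ginv G k) g))"
      if "\<zeta> \<in> {\<xi>, \<xi>', \<lambda>x. \<xi> x + \<xi>' x, \<lambda>x. \<xi> x - \<xi>' x}" for \<zeta>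
      by (rule convolution_eq_sum[OF True fin sub]) (use that in \<open>auto simp: F_def\<close>)
    then show ?thesis
      by (simp add: algebra_simps sum.distrib sum_subtractf)
  qed (simp add: convolution_outside)
  then show "convolution G (\<lambda>x. \<xi> x + \<xi>' x) \<eta> = (\<lambda>x. convolution G \<xi> \<eta> x + convolution G \<xi>' \<eta> x)"
    and "convolution G (\<lambda>x. \<xi> x - \<xi>' x) \<eta> = (\<lambda>x. convolution G \<xi> \<eta> x - convolution G \<xi>' \<eta> x)"
    by auto
qed

lemma convolution_linear_right:
  assumes Y: "openin (arr_top G) Y" and \<xi>: "\<xi> \<in> functions_on Y"
  shows "convolution G \<xi> (\<lambda>x. \<eta> x + \<eta>' x) = (\<lambda>x. convolution G \<xi> \<eta> x + convolution G \<xi> \<eta>' x)"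
    and "convolution G \<xi> (\<lambda>x. \<eta> x - \<eta>' x) = (\<lambda>x. convolution G \<xi> \<eta> x - convolution G \<xi> \<eta>' x)"
proof -
  have "convolution G \<xi> (\<lambda>x. \<eta> x + \<eta>' x) g = convolution G \<xi> \<eta> g + convolution G \<xi> \<eta>' g
    \<and> convolution G \<xi> (\<lambda>x. \<eta> x - \<eta>' x) g = convolution G \<xi> \<eta> g - convolution G \<xi> \<eta>' g" for g
  proof (cases "g \<in> arrows G")
    case True
    define F where "F = {k. \<xi> k \<noteq> 0 \<and> rng G k = rng G g}"
    have fin: "finite F"
      unfolding F_def using finite_range_fibre[OF Y] \<xi> by blast
    have sub: "F \<subseteq> {k \<in> arrows G. rng G k = rng G g}"
      using functions_on_zero_outside[OF Y] \<xi> openin_arr_subset[OF Y] unfolding F_def by blast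
    have "convolution G \<xi> \<zeta> g = (\<Sum>k\<in>F. \<xi> k * \<zeta> (cmp G (ginv G k) g))" for \<zeta>
      by (rule convolution_eq_sum[OF True fin sub]) (auto simp: F_def)
    then show ?thesis
      by (simp add: algebra_simps sum.distrib sum_subtractf)
  qed (simp add: convolution_outside)
  then show "convolution G \<xi> (\<lambda>x. \<eta> x + \<eta>' x) = (\<lambda>x. convolution G \<xi> \<eta> x + convolution G \<xi> \<eta>' x)"
    and "convolution G \<xi> (\<lambda>x. \<eta> x - \<eta>' x) = (\<lambda>x. convolution G \<xi> \<eta> x - convolution G \<xi> \<eta>' x)"
    by auto
qed

lemma set_cmp_subset: "U \<subseteq> arrows G \<Longrightarrow> V \<subseteq> arrows G \<Longrightarrow> set_cmp U V \<subseteq> arrows G"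
  by (auto simp: set_cmp_def subset_iff)

lemma set_cmp_assoc:
  assumes "U \<subseteq> arrows G" "V \<subseteq> arrows G" "W \<subseteq> arrows G"
  shows "set_cmp (set_cmp U V) W = set_cmp U (set_cmp V W)"
proof (intro subset_antisym subsetI)
  fix g assume "g \<in> set_cmp (set_cmp U V) W"
  then obtain u v w where g: "g = cmp G (cmp G u v) w" and uvw: "u \<in> U" "v \<in> V" "w \<in> W"
    and e: "src G u = rng G v" "src G (cmp G u v) = rng G w"
    unfolding set_cmp_def by blast
  have ar: "u \<in> arrows G" "v \<in> arrows G" "w \<in> arrows G" using uvw assms by auto
  have "g = cmp G u (cmp G v w)" "src G v = rng G w" "src G u = rng G (cmp G v w)"
    using g e ar by (simp_all add: cmp_assoc)
  then show "g \<in> set_cmp U (set_cmp V W)" using uvw unfolding set_cmp_def by blast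
next
  fix g assume "g \<in> set_cmp U (set_cmp V W)"
  then obtain u v w where g: "g = cmp G u (cmp G v w)" and uvw: "u \<in> U" "v \<in> V" "w \<in> W"
    and e: "src G v = rng G w" "src G u = rng G (cmp G v w)"
    unfolding set_cmp_def by blast
  have ar: "u \<in> arrows G" "v \<in> arrows G" "w \<in> arrows G" using uvw assms by auto
  have "g = cmp G (cmp G u v) w" "src G u = rng G v" "src G (cmp G u v) = rng G w"
    using g e ar by (simp_all add: cmp_assoc)
  then show "g \<in> set_cmp (set_cmp U V) W" using uvw unfolding set_cmp_def by blast
qed

text \<open>At \<open>g\<close> at most one arrow \<open>u\<close> of \<open>U\<close> has the range of \<open>g\<close>, and \<open>g\<close> lies in the product of \<open>U\<close> and
  \<open>V\<close> exactly when \<open>u\<close> exists and its inverse carries \<open>g\<close> into \<open>V\<close>.\<close>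

lemma convolution_indicator:
  assumes U: "compact_open_bisection U" and V: "V \<subseteq> arrows G"
  shows "convolution G (indicator U) (indicator V) = indicator (set_cmp U V)"
proof
  fix g
  have UG: "U \<subseteq> arrows G" and inj: "inj_on (rng G) U"
    using U openin_arr_subset by (auto simp: compact_open_bisection_def)
  show "convolution G (indicator U) (indicator V) g = indicator (set_cmp U V) g"
  proof (cases "g \<in> arrows G")
    case False
    then show ?thesis using set_cmp_subset[OF UG V] by (auto simp: convolution_outside indicator_def)
  next
    case g: True
    show ?thesis
    proof (cases "\<exists>u\<in>U. rng G u = rng G g")
      case True
      then obtain u where u: "u \<in> U" "rng G u = rng G g" by blast
      have uG: "u \<in> arrows G" using u UG by auto
      have "convolution G (indicator U) (indicator V) g =
          (\<Sum>k\<in>{u}. indicator U k * indicator V (cmp G (ginv G k) g))"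
        by (rule convolution_eq_sum[OF g]) (use u uG inj in \<open>auto simp: indicator_def inj_on_def split: if_splits\<close>)
      also have "\<dots> = indicator V (cmp G (ginv G u) g)" using u by simp
      also have "\<dots> = indicator (set_cmp U V) g"
      proof -
        have "cmp G (ginv G u) g \<in> V \<longleftrightarrow> g \<in> set_cmp U V"
        proof
          assume "cmp G (ginv G u) g \<in> V"
          moreover have "g = cmp G u (cmp G (ginv G u) g)" "src G u = rng G (cmp G (ginv G u) g)"
            using u uG g by (simp_all add: cancel_ginv_left)
          ultimately show "g \<in> set_cmp U V" using u unfolding set_cmp_def by blast
        next
          assume "g \<in> set_cmp U V"
          then obtain u' v where v: "g = cmp G u' v" "u' \<in> U" "v \<in> V" "src G u' = rng G v"
            unfolding set_cmp_def by blast
          have ar: "u' \<in> arrows G" "v \<in> arrows G" using v UG V by auto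
          then have "u' = u" using v u inj by (auto simp: inj_on_def)
          then show "cmp G (ginv G u) g \<in> V" using v ar by (simp add: ginv_cancel_left)
        qed
        then show ?thesis by (simp add: indicator_def)
      qed
      finally show ?thesis .
    next
      case False
      have "convolution G (indicator U) (indicator V) g =
          (\<Sum>k\<in>{}. indicator U k * indicator V (cmp G (ginv G k) g))"
        by (rule convolution_eq_sum[OF g]) (use False in \<open>auto simp: indicator_def split: if_splits\<close>)
      moreover have "g \<notin> set_cmp U V"
        using False UG V by (auto simp: set_cmp_def subset_iff)
      ultimately show ?thesis by simp
    qed
  qed
qed

text \<open>One statement gives the ring product and both actions on the bimodule: with bilinearity, only products of
  bisections have to be placed in \<open>Z\<close>.\<close>

lemma convolution_closed:
  assumes op: "openin (arr_top G) X" "openin (arr_top G) Y" "openin (arr_top G) Z"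
    and cmp: "set_cmp X Y \<subseteq> Z"
    and \<xi>: "\<xi> \<in> functions_on X" and \<eta>: "\<eta> \<in> functions_on Y"
  shows "convolution G \<xi> \<eta> \<in> functions_on Z"
proof -
  note F = pointwise_subgroup[OF subgroup_int_functions]
  show ?thesis using op(1) \<xi>
  proof (induction rule: functions_on_induct)
    case U: (bisection U)
    have UX: "indicator U \<in> functions_on X" using indicator_in_functions_on op(1) U by blast
    show ?case using op(2) \<eta>
    proof (induction rule: functions_on_induct)
      case V: (bisection V)
      have "set_cmp U V \<subseteq> Z" using U V cmp unfolding set_cmp_def by blast
      then have "indicator (set_cmp U V) \<in> functions_on Z"
        using U V op(3) compact_open_bisection_set_cmp indicator_in_functions_on by blast
      then show ?case
        using convolution_indicator[OF U(1), of V] V openin_arr_subset[OF op(2)] by auto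
    next
      case (diff f g)
      then show ?case using F(3) by (simp add: convolution_linear_right[OF op(1) UX])
    qed
  next
    case (diff f g)
    then show ?case using F(3) by (simp add: convolution_linear_left[OF op(1)])
  qed
qed

lemma convolution_closed_arrows:
  "\<xi> \<in> functions_on (arrows G) \<Longrightarrow> \<eta> \<in> functions_on (arrows G)
    \<Longrightarrow> convolution G \<xi> \<eta> \<in> functions_on (arrows G)"
  by (rule convolution_closed[of "arrows G" "arrows G"])
    (use openin_topspace[of "arr_top G"] set_cmp_subset in auto)

text \<open>By trilinearity this is associativity of the product of sets of arrows.\<close>

lemma convolution_assoc:
  assumes "\<xi> \<in> functions_on (arrows G)" "\<eta> \<in> functions_on (arrows G)" "\<zeta> \<in> functions_on (arrows G)"
  shows "convolution G (convolution G \<xi> \<eta>) \<zeta> = convolution G \<xi> (convolution G \<eta> \<zeta>)"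
proof -
  have op: "openin (arr_top G) (arrows G)" using openin_topspace[of "arr_top G"] by simp
  note cl = convolution_closed_arrows
  note left = convolution_linear_left(2)[OF op] and right = convolution_linear_right(2)[OF op]
  show ?thesis using op assms(1)
  proof (induction rule: functions_on_induct)
    case U: (bisection U)
    have Uf: "indicator U \<in> functions_on (arrows G)" using indicator_in_functions_on op U by blast
    show ?case using op assms(2)
    proof (induction rule: functions_on_induct)
      case V: (bisection V)
      have Vf: "indicator V \<in> functions_on (arrows G)" using indicator_in_functions_on op V by blast
      show ?case using op assms(3)
      proof (induction rule: functions_on_induct)
        case W: (bisection W)
        show ?case
          using U V W by (simp add: convolution_indicator compact_open_bisection_set_cmp
              set_cmp_subset set_cmp_assoc)
      next
        case (diff f g)
        then show ?case by (simp add: right Uf Vf cl)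
      qed
    next
      case (diff f g)
      then show ?case by (simp add: left right Uf cl assms)
    qed
  next
    case (diff f g)
    then show ?case by (simp add: left cl assms)
  qed
qed

lemma convolution_unit_indicator:
  assumes K: "K \<subseteq> units G" and \<xi>: "\<And>g. \<xi> g \<noteq> 0 \<Longrightarrow> g \<in> arrows G \<and> rng G g \<in> K"
  shows "convolution G (indicator K) \<xi> = \<xi>"
proof
  fix g
  show "convolution G (indicator K) \<xi> g = \<xi> g"
  proof (cases "g \<in> arrows G")
    case False
    then show ?thesis using \<xi> by (auto simp: convolution_outside)
  next
    case True
    have "convolution G (indicator K) \<xi> g = (\<Sum>k\<in>{rng G g}. indicator K k * \<xi> (cmp G (ginv G k) g))"
    proof (rule convolution_eq_sum[OF True])
      fix k assume "rng G k = rng G g" "indicator K k \<noteq> (0::int)"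
      then have "k \<in> units G" using K by (auto simp: indicator_def split: if_splits)
      then show "k \<in> {rng G g}" using \<open>rng G k = rng G g\<close> by simp
    qed (use True in auto)
    also have "\<dots> = indicator K (rng G g) * \<xi> g"
      using True by (cases "rng G g \<in> K") simp_all
    also have "\<dots> = \<xi> g" using \<xi>[of g] by (auto simp: indicator_def)
    finally show ?thesis .
  qed
qed

text \<open>Local units: the indicator of a compact open set of units that contains the ranges of both supports.\<close>

lemma functions_on_left_unit:
  assumes Y: "openin (arr_top G) Y" and Z: "openin (arr_top G) Z" "rng G ` Y \<subseteq> Z"
    and f: "f \<in> functions_on Y" "g \<in> functions_on Y"
  obtains e where "e \<in> functions_on Z" "convolution G e f = f" "convolution G e g = g"
proof -
  obtain K L where K: "compact_open_bisection K" "K \<subseteq> rng G ` Y"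
      "\<And>h. f h \<noteq> 0 \<Longrightarrow> h \<in> Y \<and> rng G h \<in> K"
    and L: "compact_open_bisection L" "L \<subseteq> rng G ` Y"
      "\<And>h. g h \<noteq> 0 \<Longrightarrow> h \<in> Y \<and> rng G h \<in> L"
    using functions_on_support[OF Y] f by metis
  have YG: "Y \<subseteq> arrows G" using Y openin_arr_subset by blast
  then have "rng G ` Y \<subseteq> units G" by auto
  then have sub: "K \<union> L \<subseteq> units G" using K(2) L(2) by blast
  have "compact_open_bisection (K \<union> L)"
    using K(1) L(1) sub by (rule compact_open_bisection_Un_units)
  then have "indicator (K \<union> L) \<in> functions_on Z"
    using K(2) L(2) Z by (intro indicator_in_functions_on) auto
  moreover have "convolution G (indicator (K \<union> L)) f = f" "convolution G (indicator (K \<union> L)) g = g"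
    using K(3) L(3) YG by (auto intro!: convolution_unit_indicator[OF sub])
  ultimately show thesis by (rule that)
qed

end

section \<open>Open subgroupoids\<close>

locale ample_open_subgroupoid = ample G for G :: "'g groupoid" +
  fixes H :: "'g groupoid"
  assumes subgroupoid: "open_subgroupoid H G"

sublocale ample_open_subgroupoid \<subseteq> H: algebraic_groupoid H
  using subgroupoid by unfold_locales (simp add: open_subgroupoid_def)

context ample_open_subgroupoid
begin

lemma open_arrows_H: "openin (arr_top G) (arrows H)"
  and arr_top_H: "arr_top H = subtopology (arr_top G) (arrows H)"
  using subgroupoid by (auto simp: open_subgroupoid_def)

lemma src_H [simp]: "g \<in> arrows H \<Longrightarrow> src H g = src G g"
  and rng_H [simp]: "g \<in> arrows H \<Longrightarrow> rng H g = rng G g"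
  and ginv_H [simp]: "g \<in> arrows H \<Longrightarrow> ginv H g = ginv G g"
  and cmp_H [simp]:
    "g \<in> arrows H \<Longrightarrow> h \<in> arrows H \<Longrightarrow> src G g = rng G h \<Longrightarrow> cmp H g h = cmp G g h"
  using subgroupoid by (auto simp: open_subgroupoid_def composable_def)

lemma arrows_H_subset: "g \<in> arrows H \<Longrightarrow> g \<in> arrows G"
  using openin_arr_subset[OF open_arrows_H] by blast

lemma rng_arr_H: "g \<in> arrows H \<Longrightarrow> rng G g \<in> arrows H"
  and ginv_arr_H: "g \<in> arrows H \<Longrightarrow> ginv G g \<in> arrows H"
  and cmp_arr_H: "g \<in> arrows H \<Longrightarrow> h \<in> arrows H \<Longrightarrow> src G g = rng G h \<Longrightarrow> cmp G g h \<in> arrows H"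
  using H.rng_arr[of g] H.ginv_arr[of g] H.cmp_arr[of g h] by auto

lemma units_H: "units H = src G ` arrows H"
  unfolding units_def by (rule image_cong) auto

text \<open>The open set \<open>G\<^bsub>H\<^sup>0\<^esub>\<close>.\<close>

definition source_in_H :: "'g set"
  where "source_in_H = {g \<in> arrows G. src G g \<in> units H}"

lemma open_source_in_H: "openin (arr_top G) source_in_H"
  using openin_continuous_map_preimage[OF src_continuous, of "units H"] open_src_image[OF open_arrows_H]
  by (simp add: source_in_H_def units_H)

lemma arrows_H_source: "arrows H \<subseteq> source_in_H"
  using arrows_H_subset by (auto simp: source_in_H_def units_H)

lemma source_in_H_arrows: "source_in_H \<subseteq> arrows G"
  by (auto simp: source_in_H_def)

lemma open_arrows: "openin (arr_top G) (arrows G)"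
  using openin_topspace[of "arr_top G"] by simp

lemma carrier_ring_G: "carrier (groupoid_ring G) = functions_on (arrows G)"
  by (simp add: groupoid_ring_def functions_on_arrows)

lemma carrier_ring_H: "carrier (groupoid_ring H) = functions_on (arrows H)"
  by (simp add: groupoid_ring_def arr_top_H)

lemma carrier_bimodule: "carrier (ind_bimodule G H) = functions_on source_in_H"
  by (simp add: ind_bimodule_def source_in_H_def)

lemma ring_H_subset_bimodule: "carrier (groupoid_ring H) \<subseteq> carrier (ind_bimodule G H)"
  and bimodule_subset_ring_G: "carrier (ind_bimodule G H) \<subseteq> carrier (groupoid_ring G)"
  unfolding carrier_ring_G carrier_ring_H carrier_bimodule
  using functions_on_mono open_arrows_H open_source_in_H open_arrows arrows_H_source source_in_H_arrows
  by blast+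

text \<open>A nonzero term at \<open>g\<close> writes \<open>g\<close> as a product of two arrows of \<open>H\<close>. Hence no term is lost in passing
  from \<open>G\<close> to \<open>H\<close>, and outside \<open>H\<close> all terms vanish.\<close>

lemma convolution_H_eq:
  assumes \<xi>: "\<xi> \<in> carrier (groupoid_ring H)" and \<eta>: "\<eta> \<in> carrier (groupoid_ring H)"
  shows "convolution H \<xi> \<eta> = convolution G \<xi> \<eta>"
proof
  fix g
  have z: "\<zeta> x = 0" if "\<zeta> \<in> {\<xi>, \<eta>}" "x \<notin> arrows H" for \<zeta> x
    using functions_on_zero_outside[OF open_arrows_H] \<xi> \<eta> that unfolding carrier_ring_H by blast
  show "convolution H \<xi> \<eta> g = convolution G \<xi> \<eta> g"
  proof (cases "g \<in> arrows H")
    case True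
    have eq: "{h. h \<in> arrows H \<and> src H h = rng H g \<and> \<xi> (ginv H h) * \<eta> (cmp H h g) \<noteq> 0}
        = {h. h \<in> arrows G \<and> src G h = rng G g \<and> \<xi> (ginv G h) * \<eta> (cmp G h g) \<noteq> 0}"
      (is "?L = ?R")
    proof (intro subset_antisym subsetI)
      fix h assume "h \<in> ?L"
      then show "h \<in> ?R" using True arrows_H_subset by auto
    next
      fix h assume h: "h \<in> ?R"
      then have "ginv G h \<in> arrows H" using z[of \<xi> "ginv G h"] by auto
      then have "ginv G (ginv G h) \<in> arrows H" by (rule ginv_arr_H)
      then show "h \<in> ?L" using h True by auto
    qed
    have "(\<Sum>h\<in>?L. \<xi> (ginv H h) * \<eta> (cmp H h g)) = (\<Sum>h\<in>?L. \<xi> (ginv G h) * \<eta> (cmp G h g))"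
      using True by (intro sum.cong) auto
    then show ?thesis
      unfolding convolution_def using True arrows_H_subset[OF True] by (simp only: eq if_True)
  next
    case False
    have "\<xi> (ginv G h) * \<eta> (cmp G h g) = 0"
      if h: "h \<in> arrows G" "src G h = rng G g" and g: "g \<in> arrows G" for h
    proof (rule ccontr)
      assume "\<not> ?thesis"
      then have H: "ginv G h \<in> arrows H" "cmp G h g \<in> arrows H"
        using z[of \<xi> "ginv G h"] z[of \<eta> "cmp G h g"] by auto
      then have "cmp G (ginv G h) (cmp G h g) \<in> arrows H"
        using h g by (intro cmp_arr_H[OF H]) simp
      then show False using False h g by (simp add: ginv_cancel_left)
    qed
    then have "convolution G \<xi> \<eta> g = 0" by (auto simp: convolution_def intro!: sum.neutral)
    then show ?thesis using False by (simp add: convolution_def)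
  qed
qed

lemma bimodule_left_closed:
  assumes "\<xi> \<in> carrier (groupoid_ring G)" "\<eta> \<in> carrier (ind_bimodule G H)"
  shows "convolution G \<xi> \<eta> \<in> carrier (ind_bimodule G H)"
  using assms unfolding carrier_ring_G carrier_bimodule
  by (intro convolution_closed[OF open_arrows open_source_in_H open_source_in_H])
    (auto simp: set_cmp_def source_in_H_def)

lemma bimodule_right_closed:
  assumes "\<xi> \<in> carrier (ind_bimodule G H)" "\<eta> \<in> carrier (groupoid_ring H)"
  shows "convolution G \<xi> \<eta> \<in> carrier (ind_bimodule G H)"
  using assms unfolding carrier_ring_H carrier_bimodule
  by (intro convolution_closed[OF open_source_in_H open_arrows_H open_source_in_H])
    (use arrows_H_subset in \<open>auto simp: set_cmp_def source_in_H_def units_H\<close>)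

lemma ring_H_left_unit:
  assumes "a \<in> carrier (groupoid_ring H)" "b \<in> carrier (groupoid_ring H)"
  obtains e where "e \<in> carrier (groupoid_ring H)" "convolution G e a = a" "convolution G e b = b"
proof -
  have "rng G ` arrows H \<subseteq> arrows H" using rng_arr_H by auto
  then show thesis
    using that unfolding carrier_ring_H
    by (rule functions_on_left_unit[OF open_arrows_H open_arrows_H _ assms[unfolded carrier_ring_H]])
qed

lemma bimodule_left_unit:
  assumes "a \<in> carrier (ind_bimodule G H)"
  obtains e where "e \<in> carrier (groupoid_ring G)" "convolution G e a = a"
proof -
  have "rng G ` source_in_H \<subseteq> arrows G" by (auto simp: source_in_H_def)
  then show thesis
    using that unfolding carrier_ring_G
    by (rule functions_on_left_unit[OF open_source_in_H open_arrows _ assms[unfolded carrier_bimodule]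
        assms[unfolded carrier_bimodule]])
qed

end

section \<open>Tensor products as quotients of free abelian groups\<close>

lemma hom_eq_on_generate:
  assumes f: "group_hom G K f" and g: "group_hom G K g" and S: "S \<subseteq> carrier G"
    and eq: "\<And>s. s \<in> S \<Longrightarrow> f s = g s" and x: "x \<in> generate G S"
  shows "f x = g x"
proof -
  interpret f: group_hom G K f by (rule f)
  interpret g: group_hom G K g by (rule g)
  show ?thesis using x
  proof (induction rule: generate.induct)
    case (inv h)
    then show ?case using eq S by (auto simp: subset_iff)
  next
    case (eng h1 h2)
    then show ?case using f.G.generate_in_carrier[OF S] by simp
  qed (use eq in auto)
qed

text \<open>The universal property of the free abelian group, with an explicit extension of \<open>b\<close>. The counit is defined by
  this formula.\<close>

lemma (in comm_group) formal_sum_hom: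
  assumes b: "b ` X \<subseteq> carrier G"
  defines "h \<equiv> \<lambda>c. finprod G (\<lambda>p. b p [^] Poly_Mapping.lookup c p) (Poly_Mapping.keys c)"
  shows "h \<in> hom (free_Abelian_group X) G"
    and "p \<in> X \<Longrightarrow> h (frag_of p) = b p"
proof -
  have ext: "h c = finprod G (\<lambda>p. b p [^] Poly_Mapping.lookup c p) U"
    if "Poly_Mapping.keys c \<subseteq> U" "U \<subseteq> X" "finite U" for c U
    unfolding h_def
    by (rule finprod_mono_neutral_cong_left) (use that b in \<open>auto simp: in_keys_iff image_subset_iff subset_iff\<close>)
  show "h \<in> hom (free_Abelian_group X) G"
  proof (rule homI)
    fix c d assume cd: "c \<in> carrier (free_Abelian_group X)" "d \<in> carrier (free_Abelian_group X)"
    let ?U = "Poly_Mapping.keys c \<union> Poly_Mapping.keys d"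
    have U: "?U \<subseteq> X" "finite ?U" using cd by auto
    have bU: "b p \<in> carrier G" if "p \<in> ?U" for p using U b that by auto
    have "h (c + d) = finprod G (\<lambda>p. b p [^] Poly_Mapping.lookup (c + d) p) ?U"
      using U by (intro ext keys_add)
    also have "\<dots> = finprod G (\<lambda>p. b p [^] Poly_Mapping.lookup c p \<otimes> b p [^] Poly_Mapping.lookup d p) ?U"
      using bU by (intro finprod_cong') (auto simp: lookup_add int_pow_mult)
    also have "\<dots> = finprod G (\<lambda>p. b p [^] Poly_Mapping.lookup c p) ?U
        \<otimes> finprod G (\<lambda>p. b p [^] Poly_Mapping.lookup d p) ?U"
      using bU by (intro finprod_multf) auto
    also have "\<dots> = h c \<otimes> h d"
      using U ext[of c ?U] ext[of d ?U] by simp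
    finally show "h (c \<otimes>\<^bsub>free_Abelian_group X\<^esub> d) = h c \<otimes> h d" by simp
  next
    fix c assume "c \<in> carrier (free_Abelian_group X)"
    then show "h c \<in> carrier G" unfolding h_def using b by (intro finprod_closed) auto
  qed
  show "h (frag_of p) = b p" if "p \<in> X"
    using that b by (auto simp: h_def finprod_singleton)
qed

text \<open>The closure properties under which the relators lie in the free abelian group.\<close>

locale tensor_data =
  fixes R :: "('r, 'k) ring_scheme" and A :: "('a, 'l) ring_scheme"
    and \<rho> :: "'a \<Rightarrow> 'r \<Rightarrow> 'a" and N :: "('r, 'n, 'p) module_scheme"
  assumes add_A: "\<lbrakk>a \<in> carrier A; b \<in> carrier A\<rbrakk> \<Longrightarrow> a \<oplus>\<^bsub>A\<^esub> b \<in> carrier A"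
    and act_A: "\<lbrakk>a \<in> carrier A; c \<in> carrier R\<rbrakk> \<Longrightarrow> \<rho> a c \<in> carrier A"
    and add_N: "\<lbrakk>x \<in> carrier N; y \<in> carrier N\<rbrakk> \<Longrightarrow> x \<oplus>\<^bsub>N\<^esub> y \<in> carrier N"
    and act_N: "\<lbrakk>c \<in> carrier R; x \<in> carrier N\<rbrakk> \<Longrightarrow> c \<odot>\<^bsub>N\<^esub> x \<in> carrier N"
begin

abbreviation "free \<equiv> free_Abelian_group (carrier A \<times> carrier N)"
abbreviation "relators \<equiv> tensor_relators R A \<rho> N"
abbreviation "null \<equiv> tensor_null R A \<rho> N"
abbreviation "T \<equiv> tensor_group R A \<rho> N"
abbreviation "coset \<equiv> tensor_coset R A \<rho> N"

definition tensor :: "'a \<Rightarrow> 'n \<Rightarrow> ('a \<times> 'n \<Rightarrow>\<^sub>0 int) set"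
  where "tensor a x = coset (frag_of (a, x))"

lemma relators_free: "relators \<subseteq> carrier free"
proof -
  have 2: "frag_of p - frag_of q \<in> carrier free"
    if "p \<in> carrier A \<times> carrier N" "q \<in> carrier A \<times> carrier N" for p q :: "'a \<times> 'n"
    using that keys_diff[of "frag_of p" "frag_of q"] by auto
  have 3: "frag_of p - frag_of q - frag_of r \<in> carrier free"
    if "p \<in> carrier A \<times> carrier N" "q \<in> carrier A \<times> carrier N" "r \<in> carrier A \<times> carrier N"
    for p q r :: "'a \<times> 'n"
    using 2[OF that(1,2)] that(3) keys_diff[of "frag_of p - frag_of q" "frag_of r"] by auto
  show ?thesis
  proof
    fix r assume "r \<in> relators"
    then show "r \<in> carrier free"
      unfolding tensor_relators_def
    proof (elim UnE CollectE exE conjE)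
    qed (simp_all only: 2 3 mem_Sigma_iff add_A act_A add_N act_N)
  qed
qed

lemma subgroup_null: "subgroup null free"
  unfolding tensor_null_def by (rule group.generate_is_subgroup[OF group_free_Abelian_group relators_free])

lemma null_free: "n \<in> null \<Longrightarrow> n \<in> carrier free"
  using subgroup.subset[OF subgroup_null] by blast

lemma null_zero: "0 \<in> null"
  and null_add: "m \<in> null \<Longrightarrow> n \<in> null \<Longrightarrow> m + n \<in> null"
  and null_uminus: "m \<in> null \<Longrightarrow> - m \<in> null"
  using subgroup.one_closed[OF subgroup_null] subgroup.m_closed[OF subgroup_null, of m n]
    subgroup.m_inv_closed[OF subgroup_null, of m] null_free[of m] by auto

lemma null_normal: "null \<lhd> free"
  using comm_group.normal_iff_subgroup[OF abelian_free_Abelian_group] subgroup_null by blast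

lemma comm_group_T: "comm_group T"
  unfolding tensor_group_def
  by (rule comm_group.abelian_FactGroup[OF abelian_free_Abelian_group subgroup_null])

lemma carrier_T: "carrier T = coset ` carrier free"
  unfolding tensor_group_def carrier_FactGroup tensor_coset_def ..

lemma coset_closed: "c \<in> carrier free \<Longrightarrow> coset c \<in> carrier T"
  by (simp add: carrier_T)

lemma coset_eq_image: "coset c = (\<lambda>n. n + c) ` null"
  by (auto simp: tensor_coset_def r_coset_def)

lemma coset_self: "c \<in> coset c"
  using null_zero by (auto simp: coset_eq_image intro!: image_eqI[of _ _ 0])

lemma coset_add_null:
  assumes "n \<in> null"
  shows "coset (n + c) = coset c"
proof -
  have "m + (n + c) \<in> coset c" if "m \<in> null" for m
    using null_add[OF that assms] by (auto simp: coset_eq_image intro!: image_eqI[of _ _ "m + n"])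
  moreover have "m + c \<in> coset (n + c)" if "m \<in> null" for m
    using null_add[OF that null_uminus[OF assms]]
    by (auto simp: coset_eq_image intro!: image_eqI[of _ _ "m + - n"])
  ultimately show ?thesis by (auto simp: coset_eq_image)
qed

lemma coset_hom: "coset \<in> hom free T"
  using normal.r_coset_hom_Mod[OF null_normal] unfolding tensor_group_def
  by (simp add: tensor_coset_def[abs_def])

lemma coset_add:
  "c \<in> carrier free \<Longrightarrow> d \<in> carrier free \<Longrightarrow> coset (c + d) = coset c \<otimes>\<^bsub>T\<^esub> coset d"
  using hom_mult[OF coset_hom] by simp

lemma one_T: "\<one>\<^bsub>T\<^esub> = null"
  by (simp add: tensor_group_def)

lemma coset_null: "n \<in> null \<Longrightarrow> coset n = \<one>\<^bsub>T\<^esub>"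
  using coset_add_null[of n 0] by (simp add: coset_eq_image one_T)

lemma group_hom_coset: "group_hom free T coset"
  using coset_hom comm_group.axioms(2)[OF comm_group_T]
  by (simp add: group_hom_def group_hom_axioms_def)

lemma tensor_closed [simp]: "a \<in> carrier A \<Longrightarrow> x \<in> carrier N \<Longrightarrow> tensor a x \<in> carrier T"
  by (simp add: tensor_def coset_closed)

lemma coset_diff: 
  assumes "c \<in> carrier free" "d \<in> carrier free"
  shows "coset (c - d) = coset c \<otimes>\<^bsub>T\<^esub> inv\<^bsub>T\<^esub> coset d"
proof -
  interpret c: group_hom free T coset by (rule group_hom_coset)
  have "coset (c - d) = coset (c \<otimes>\<^bsub>free\<^esub> inv\<^bsub>free\<^esub> d)" using assms by simp
  also have "\<dots> = coset c \<otimes>\<^bsub>T\<^esub> inv\<^bsub>T\<^esub> coset d"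
    using assms c.H.inv_closed by (metis c.G.inv_closed c.hom_inv c.hom_mult)
  finally show ?thesis .
qed

lemma carrier_T_generate: "carrier T = generate T {tensor a x | a x. a \<in> carrier A \<and> x \<in> carrier N}"
    (is "_ = generate T ?X")
proof
  interpret comm_group T by (rule comm_group_T)
  have X: "?X \<subseteq> carrier T" by auto
  then show "generate T ?X \<subseteq> carrier T" by (rule generate_incl)
  show "carrier T \<subseteq> generate T ?X"
  proof
    fix t assume "t \<in> carrier T"
    then obtain c where c: "Poly_Mapping.keys c \<subseteq> carrier A \<times> carrier N" and t: "t = coset c"
      by (auto simp: carrier_T)
    from c show "t \<in> generate T ?X" unfolding t
    proof (induction rule: free_Abelian_group_induct[consumes 1, case_names zero diff frag_of])
      case zero
      then show ?case using coset_null[OF null_zero] generate.one[of T] by simp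
    next
      case (diff c d)
      then have eq: "coset (c - d) = coset c \<otimes>\<^bsub>T\<^esub> inv\<^bsub>T\<^esub> coset d"
        by (intro coset_diff) simp_all
      show ?case
        unfolding eq by (intro generate.eng generate_m_inv_closed[OF X] diff.IH)
    next
      case (frag_of p)
      then show ?case by (cases p) (auto simp: tensor_def[symmetric] intro: generate.incl)
    qed
  qed
qed

text \<open>Additive maps out of a tensor product are compared on pure tensors. All identities between maps of induced
  modules below are proved in this way.\<close>

lemma T_hom_eqI:
  assumes "f \<in> hom T K" "g \<in> hom T K" "group K"
    and "\<And>a x. a \<in> carrier A \<Longrightarrow> x \<in> carrier N \<Longrightarrow> f (tensor a x) = g (tensor a x)"
    and "t \<in> carrier T"
  shows "f t = g t"
proof (rule hom_eq_on_generate[where G = T and K = K])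
  show "group_hom T K f" "group_hom T K g"
    using assms comm_group.axioms(2)[OF comm_group_T] by (auto simp: group_hom_def group_hom_axioms_def)
  show "t \<in> generate T {tensor a x | a x. a \<in> carrier A \<and> x \<in> carrier N}"
    using assms(5) carrier_T_generate by blast
qed (use assms in auto)

lemma tensor_add_left:
  assumes "a \<in> carrier A" "b \<in> carrier A" "x \<in> carrier N"
  shows "tensor (a \<oplus>\<^bsub>A\<^esub> b) x = tensor a x \<otimes>\<^bsub>T\<^esub> tensor b x"
proof -
  have "frag_of (a \<oplus>\<^bsub>A\<^esub> b, x) - frag_of (a, x) - frag_of (b, x) \<in> null"
    unfolding tensor_null_def tensor_relators_def using assms by (intro generate.incl) blast
  from coset_add_null[OF this, of "frag_of (a, x) + frag_of (b, x)"] show ?thesis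
    using assms by (simp add: tensor_def coset_add)
qed

lemma tensor_add_right:
  assumes "a \<in> carrier A" "x \<in> carrier N" "y \<in> carrier N"
  shows "tensor a (x \<oplus>\<^bsub>N\<^esub> y) = tensor a x \<otimes>\<^bsub>T\<^esub> tensor a y"
proof -
  have "frag_of (a, x \<oplus>\<^bsub>N\<^esub> y) - frag_of (a, x) - frag_of (a, y) \<in> null"
    unfolding tensor_null_def tensor_relators_def using assms by (intro generate.incl) blast
  from coset_add_null[OF this, of "frag_of (a, x) + frag_of (a, y)"] show ?thesis
    using assms by (simp add: tensor_def coset_add)
qed

lemma tensor_balanced:
  assumes "a \<in> carrier A" "c \<in> carrier R" "x \<in> carrier N"
  shows "tensor (\<rho> a c) x = tensor a (c \<odot>\<^bsub>N\<^esub> x)"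
proof -
  have "frag_of (\<rho> a c, x) - frag_of (a, c \<odot>\<^bsub>N\<^esub> x) \<in> null"
    unfolding tensor_null_def tensor_relators_def using assms by (intro generate.incl) blast
  from coset_add_null[OF this, of "frag_of (a, c \<odot>\<^bsub>N\<^esub> x)"] show ?thesis
    by (simp add: tensor_def)
qed

definition balanced :: "('y, 'z) monoid_scheme \<Rightarrow> ('a \<Rightarrow> 'n \<Rightarrow> 'y) \<Rightarrow> bool"
  where "balanced K \<beta> \<longleftrightarrow>
    (\<forall>a\<in>carrier A. \<forall>x\<in>carrier N. \<beta> a x \<in> carrier K)
  \<and> (\<forall>a\<in>carrier A. \<forall>b\<in>carrier A. \<forall>x\<in>carrier N. \<beta> (a \<oplus>\<^bsub>A\<^esub> b) x = \<beta> a x \<otimes>\<^bsub>K\<^esub> \<beta> b x)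
  \<and> (\<forall>a\<in>carrier A. \<forall>x\<in>carrier N. \<forall>y\<in>carrier N. \<beta> a (x \<oplus>\<^bsub>N\<^esub> y) = \<beta> a x \<otimes>\<^bsub>K\<^esub> \<beta> a y)
  \<and> (\<forall>a\<in>carrier A. \<forall>c\<in>carrier R. \<forall>x\<in>carrier N. \<beta> (\<rho> a c) x = \<beta> a (c \<odot>\<^bsub>N\<^esub> x))"

text \<open>The universal property of the tensor product, in the form needed for maps that are defined by choosing a
  representative of a coset.\<close>

lemma balanced_hom_constant_on_coset:
  assumes K: "comm_group K" and h: "h \<in> hom free K" and bal: "balanced K (\<lambda>a x. h (frag_of (a, x)))"
    and c: "c \<in> carrier free" and d: "d \<in> coset c"
  shows "h d = h c"
proof -
  interpret K: comm_group K by (rule K)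
  interpret h: group_hom free K h
    using h K.group_axioms by (simp add: group_hom_def group_hom_axioms_def)
  have diff: "h (u - v) = h u \<otimes>\<^bsub>K\<^esub> inv\<^bsub>K\<^esub> h v" if "u \<in> carrier free" "v \<in> carrier free" for u v
    using that h.hom_mult[of u "- v"] h.hom_inv[of v] by simp
  have rel: "h r = \<one>\<^bsub>K\<^esub>" if "r \<in> relators" for r
  proof -
    have cl: "h (frag_of (a, x)) \<in> carrier K" if "a \<in> carrier A" "x \<in> carrier N" for a x
      using that by (intro h.hom_closed) simp
    have keys: "frag_of p - frag_of q \<in> carrier free"
      if "p \<in> carrier A \<times> carrier N" "q \<in> carrier A \<times> carrier N" for p q
      using keys_diff[of "frag_of p" "frag_of q"] that by auto
    from \<open>r \<in> relators\<close> show ?thesis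
      unfolding tensor_relators_def
    proof (elim UnE CollectE exE conjE)
      fix a b x assume r: "r = frag_of (a \<oplus>\<^bsub>A\<^esub> b, x) - frag_of (a, x) - frag_of (b, x)"
        and m: "a \<in> carrier A" "b \<in> carrier A" "x \<in> carrier N"
      have "h r = h (frag_of (a \<oplus>\<^bsub>A\<^esub> b, x)) \<otimes>\<^bsub>K\<^esub> inv\<^bsub>K\<^esub> h (frag_of (a, x)) \<otimes>\<^bsub>K\<^esub> inv\<^bsub>K\<^esub> h (frag_of (b, x))"
        unfolding r using m keys[of "(a \<oplus>\<^bsub>A\<^esub> b, x)" "(a, x)"] add_A by (simp add: diff)
      also have "\<dots> = \<one>\<^bsub>K\<^esub>"
        using bal m cl by (simp add: balanced_def K.m_assoc K.m_comm[of "h (frag_of (a, x))"] K.inv_solve_right)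
      finally show ?thesis .
    next
      fix a x y assume r: "r = frag_of (a, x \<oplus>\<^bsub>N\<^esub> y) - frag_of (a, x) - frag_of (a, y)"
        and m: "a \<in> carrier A" "x \<in> carrier N" "y \<in> carrier N"
      have "h r = h (frag_of (a, x \<oplus>\<^bsub>N\<^esub> y)) \<otimes>\<^bsub>K\<^esub> inv\<^bsub>K\<^esub> h (frag_of (a, x)) \<otimes>\<^bsub>K\<^esub> inv\<^bsub>K\<^esub> h (frag_of (a, y))"
        unfolding r using m keys[of "(a, x \<oplus>\<^bsub>N\<^esub> y)" "(a, x)"] add_N by (simp add: diff)
      also have "\<dots> = \<one>\<^bsub>K\<^esub>"
        using bal m cl by (simp add: balanced_def K.m_assoc K.m_comm[of "h (frag_of (a, x))"] K.inv_solve_right)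
      finally show ?thesis .
    next
      fix a c x assume r: "r = frag_of (\<rho> a c, x) - frag_of (a, c \<odot>\<^bsub>N\<^esub> x)"
        and m: "a \<in> carrier A" "c \<in> carrier R" "x \<in> carrier N"
      then show ?thesis
        using bal cl act_A act_N by (simp add: diff balanced_def)
    qed
  qed
  have "h n = \<one>\<^bsub>K\<^esub>" if "n \<in> null" for n
  proof -
    interpret one: group_hom free K "\<lambda>_. \<one>\<^bsub>K\<^esub>"
      using h.group_hom_axioms by unfold_locales (auto simp: hom_def)
    show ?thesis
      using hom_eq_on_generate[OF h.group_hom_axioms one.group_hom_axioms relators_free] rel that
      unfolding tensor_null_def by blast
  qed
  moreover obtain n where "n \<in> null" "d = n + c" using d by (auto simp: coset_eq_image)
  ultimately show ?thesis
    using h.hom_mult[of n c] null_free c by simp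
qed

end

text \<open>The values of \<open>\<phi>\<close> are pairs, which can be added only as pure tensors. So balancedness is stated for the
  pure tensors of the values.\<close>

lemma tensor_map_coset:
  assumes D: "tensor_data R A \<rho> N" and D': "tensor_data R' A' \<rho>' N'"
    and \<phi>: "\<And>a x. a \<in> carrier A \<Longrightarrow> x \<in> carrier N \<Longrightarrow> \<phi> (a, x) \<in> carrier A' \<times> carrier N'"
    and bal: "tensor_data.balanced R A \<rho> N (tensor_group R' A' \<rho>' N')
      (\<lambda>a x. tensor_coset R' A' \<rho>' N' (frag_of (\<phi> (a, x))))"
  shows "tensor_map R' A' \<rho>' N' \<phi> \<in> hom (tensor_group R A \<rho> N) (tensor_group R' A' \<rho>' N')"
    and "\<And>a x. a \<in> carrier A \<Longrightarrow> x \<in> carrier N \<Longrightarrow>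
      tensor_map R' A' \<rho>' N' \<phi> (tensor_coset R A \<rho> N (frag_of (a, x)))
        = tensor_coset R' A' \<rho>' N' (frag_of (\<phi> (a, x)))"
proof -
  interpret D: tensor_data R A \<rho> N by (rule D)
  interpret D': tensor_data R' A' \<rho>' N' by (rule D')
  let ?e = "frag_extend (\<lambda>p. frag_of (\<phi> p))"
  let ?h = "\<lambda>c. D'.coset (?e c)"
  have e: "?e c \<in> carrier D'.free" if "c \<in> carrier D.free" for c
    using that \<phi> keys_frag_extend[of "\<lambda>p. frag_of (\<phi> p)" c] by fastforce
  have h: "?h \<in> hom D.free D'.T"
    using e by (auto intro!: homI D'.coset_closed simp del: carrier_free_Abelian_group_iff simp: D'.coset_add frag_extend_add)
  have const: "D'.coset (?e d) = D'.coset (?e c)" if "c \<in> carrier D.free" "d \<in> D.coset c" for c d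
    using D.balanced_hom_constant_on_coset[OF D'.comm_group_T h _ that] bal by simp
  have map: "tensor_map R' A' \<rho>' N' \<phi> (D.coset c) = D'.coset (?e c)" if "c \<in> carrier D.free" for c
    unfolding tensor_map_def using const[OF that] D.coset_self[of c] by blast
  show "tensor_map R' A' \<rho>' N' \<phi> \<in> hom D.T D'.T"
  proof (rule homI)
    fix s t assume "s \<in> carrier D.T" "t \<in> carrier D.T"
    then obtain c d where cd: "c \<in> carrier D.free" "d \<in> carrier D.free" "s = D.coset c" "t = D.coset d"
      by (auto simp: D.carrier_T simp del: carrier_free_Abelian_group_iff)
    then have "c + d \<in> carrier D.free"
      using group.is_monoid[OF group_free_Abelian_group] monoid.m_closed mult_free_Abelian_group by metis
    then show "tensor_map R' A' \<rho>' N' \<phi> (s \<otimes>\<^bsub>D.T\<^esub> t)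
        = tensor_map R' A' \<rho>' N' \<phi> s \<otimes>\<^bsub>D'.T\<^esub> tensor_map R' A' \<rho>' N' \<phi> t"
      unfolding cd(3,4) D.coset_add[OF cd(1,2), symmetric]
      using cd e by (simp add: map frag_extend_add D'.coset_add del: carrier_free_Abelian_group_iff)
  next
    fix s assume "s \<in> carrier D.T"
    then obtain c where "c \<in> carrier D.free" "s = D.coset c"
      by (auto simp: D.carrier_T simp del: carrier_free_Abelian_group_iff)
    then show "tensor_map R' A' \<rho>' N' \<phi> s \<in> carrier D'.T"
      using map e D'.coset_closed by simp
  qed
  show "tensor_map R' A' \<rho>' N' \<phi> (D.coset (frag_of (a, x))) = D'.coset (frag_of (\<phi> (a, x)))"
    if "a \<in> carrier A" "x \<in> carrier N" for a x
    using map[of "frag_of (a, x)"] that by simp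
qed

section \<open>Non-degenerate modules\<close>

locale nd_module =
  fixes R :: "('r, 'k) ring_scheme" and M :: "('r, 'm, 'l) module_scheme"
  assumes nondegenerate: "nondegenerate_module R M"

sublocale nd_module \<subseteq> abelian_group M
  using nondegenerate by (simp add: nondegenerate_module_def)

context nd_module
begin

lemma smult_closed [simp]:
    "a \<in> carrier R \<Longrightarrow> x \<in> carrier M \<Longrightarrow> a \<odot>\<^bsub>M\<^esub> x \<in> carrier M"
  and smult_add_left: "a \<in> carrier R \<Longrightarrow> b \<in> carrier R \<Longrightarrow> x \<in> carrier M \<Longrightarrow>
    (a \<oplus>\<^bsub>R\<^esub> b) \<odot>\<^bsub>M\<^esub> x = a \<odot>\<^bsub>M\<^esub> x \<oplus>\<^bsub>M\<^esub> b \<odot>\<^bsub>M\<^esub> x"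
  and smult_add_right: "a \<in> carrier R \<Longrightarrow> x \<in> carrier M \<Longrightarrow> y \<in> carrier M \<Longrightarrow>
    a \<odot>\<^bsub>M\<^esub> (x \<oplus>\<^bsub>M\<^esub> y) = a \<odot>\<^bsub>M\<^esub> x \<oplus>\<^bsub>M\<^esub> a \<odot>\<^bsub>M\<^esub> y"
  and smult_assoc: "a \<in> carrier R \<Longrightarrow> b \<in> carrier R \<Longrightarrow> x \<in> carrier M \<Longrightarrow>
    (a \<otimes>\<^bsub>R\<^esub> b) \<odot>\<^bsub>M\<^esub> x = a \<odot>\<^bsub>M\<^esub> (b \<odot>\<^bsub>M\<^esub> x)"
  and span: "action_span R M = carrier M"
  using nondegenerate by (simp_all add: nondegenerate_module_def)

lemma smult_hom: "a \<in> carrier R \<Longrightarrow> (\<lambda>x. a \<odot>\<^bsub>M\<^esub> x) \<in> hom (add_monoid M) (add_monoid M)"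
  by (auto intro!: homI simp: smult_add_right)

lemma smult_uminus:
  assumes "a \<in> carrier R" "x \<in> carrier M"
  shows "a \<odot>\<^bsub>M\<^esub> (\<ominus>\<^bsub>M\<^esub> x) = \<ominus>\<^bsub>M\<^esub> (a \<odot>\<^bsub>M\<^esub> x)"
proof -
  interpret group_hom "add_monoid M" "add_monoid M" "\<lambda>x. a \<odot>\<^bsub>M\<^esub> x"
    using smult_hom[OF assms(1)] by unfold_locales
  show ?thesis using hom_inv[of x] assms by (simp add: a_inv_def)
qed

end

lemma module_maps_closed: "f \<in> module_maps R M N \<Longrightarrow> x \<in> carrier M \<Longrightarrow> f x \<in> carrier N"
  and module_maps_add: "f \<in> module_maps R M N \<Longrightarrow> x \<in> carrier M \<Longrightarrow> y \<in> carrier M \<Longrightarrow>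
    f (x \<oplus>\<^bsub>M\<^esub> y) = f x \<oplus>\<^bsub>N\<^esub> f y"
  and module_maps_smult: "f \<in> module_maps R M N \<Longrightarrow> a \<in> carrier R \<Longrightarrow> x \<in> carrier M \<Longrightarrow>
    f (a \<odot>\<^bsub>M\<^esub> x) = a \<odot>\<^bsub>N\<^esub> f x"
  by (auto simp: module_maps_def)

lemma module_maps_hom: "f \<in> module_maps R M N \<Longrightarrow> f \<in> hom (add_monoid M) (add_monoid N)"
  by (auto simp: module_maps_def hom_def)

lemma module_mapsI:
  assumes "f \<in> hom (add_monoid M) (add_monoid N)"
    and "\<And>a x. a \<in> carrier R \<Longrightarrow> x \<in> carrier M \<Longrightarrow> f (a \<odot>\<^bsub>M\<^esub> x) = a \<odot>\<^bsub>N\<^esub> f x"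
  shows "f \<in> module_maps R M N"
  using assms by (auto simp: module_maps_def hom_def)

text \<open>The additive monoid of an induced module and the tensor product group have the same carrier and operations, but
  as records of different types they cannot be equated.\<close>

lemma generate_mono_operations:
  assumes "carrier G = carrier K" "monoid.mult G = monoid.mult K" "\<one>\<^bsub>G\<^esub> = \<one>\<^bsub>K\<^esub>"
  shows "generate G S \<subseteq> generate K S"
proof
  fix x assume "x \<in> generate G S"
  then show "x \<in> generate K S"
  proof (induction rule: generate.induct)
    case (inv h)
    then show ?case using generate.inv[of h S K] assms by (simp add: m_inv_def)
  qed (use assms in \<open>auto intro: generate.intros\<close>)
qed

lemma generate_cong_operations:
  assumes "carrier G = carrier K" "monoid.mult G = monoid.mult K" "\<one>\<^bsub>G\<^esub> = \<one>\<^bsub>K\<^esub>"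
  shows "generate G S = generate K S"
  using generate_mono_operations[of G K S] generate_mono_operations[of K G S] assms by auto

context ample_open_subgroupoid
begin

lemma ring_G_add [simp]: "\<xi> \<oplus>\<^bsub>groupoid_ring X\<^esub> \<eta> = (\<lambda>g. \<xi> g + \<eta> g)"
  and ring_G_mult [simp]: "\<xi> \<otimes>\<^bsub>groupoid_ring X\<^esub> \<eta> = convolution X \<xi> \<eta>"
  by (simp_all add: groupoid_ring_def)

lemma bimodule_add [simp]: "\<xi> \<oplus>\<^bsub>ind_bimodule G H\<^esub> \<eta> = (\<lambda>g. \<xi> g + \<eta> g)"
  by (simp add: ind_bimodule_def groupoid_ring_def)

lemma ring_G_closed_add:
    "\<xi> \<in> carrier (groupoid_ring G) \<Longrightarrow> \<eta> \<in> carrier (groupoid_ring G) \<Longrightarrow> (\<lambda>g. \<xi> g + \<eta> g) \<in> carrier (groupoid_ring G)"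
  and bimodule_closed_add:
    "\<xi> \<in> carrier (ind_bimodule G H) \<Longrightarrow> \<eta> \<in> carrier (ind_bimodule G H) \<Longrightarrow> (\<lambda>g. \<xi> g + \<eta> g) \<in> carrier (ind_bimodule G H)"
  unfolding carrier_ring_G carrier_bimodule using pointwise_subgroup(2)[OF subgroup_int_functions] by blast+

lemma ring_G_closed_mult:
    "\<xi> \<in> carrier (groupoid_ring G) \<Longrightarrow> \<eta> \<in> carrier (groupoid_ring G) \<Longrightarrow>
      convolution G \<xi> \<eta> \<in> carrier (groupoid_ring G)"
  unfolding carrier_ring_G by (rule convolution_closed_arrows)

lemma conv_add_left:
    "\<xi> \<in> carrier (groupoid_ring G) \<Longrightarrow> \<xi>' \<in> carrier (groupoid_ring G) \<Longrightarrow>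
      convolution G (\<lambda>x. \<xi> x + \<xi>' x) \<eta> = (\<lambda>x. convolution G \<xi> \<eta> x + convolution G \<xi>' \<eta> x)"
  and conv_add_right:
    "\<xi> \<in> carrier (groupoid_ring G) \<Longrightarrow>
      convolution G \<xi> (\<lambda>x. \<eta> x + \<eta>' x) = (\<lambda>x. convolution G \<xi> \<eta> x + convolution G \<xi> \<eta>' x)"
  and conv_assoc:
    "\<xi> \<in> carrier (groupoid_ring G) \<Longrightarrow> \<eta> \<in> carrier (groupoid_ring G) \<Longrightarrow> \<zeta> \<in> carrier (groupoid_ring G) \<Longrightarrow>
      convolution G (convolution G \<xi> \<eta>) \<zeta> = convolution G \<xi> (convolution G \<eta> \<zeta>)"
  unfolding carrier_ring_G
  using convolution_linear_left[OF open_arrows] convolution_linear_right[OF open_arrows] convolution_assoc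
  by blast+

lemma ring_H_in_bimodule [simp]: "\<xi> \<in> carrier (groupoid_ring H) \<Longrightarrow> \<xi> \<in> carrier (ind_bimodule G H)"
  and bimodule_in_ring_G [simp]: "\<xi> \<in> carrier (ind_bimodule G H) \<Longrightarrow> \<xi> \<in> carrier (groupoid_ring G)"
  using ring_H_subset_bimodule bimodule_subset_ring_G by blast+

lemma H_module_assoc:
  assumes "groupoid_module H M" "a \<in> carrier (groupoid_ring H)" "b \<in> carrier (groupoid_ring H)" "x \<in> carrier M"
  shows "convolution G a b \<odot>\<^bsub>M\<^esub> x = a \<odot>\<^bsub>M\<^esub> (b \<odot>\<^bsub>M\<^esub> x)"
  using nd_module.smult_assoc[OF nd_module.intro[OF assms(1)] assms(2,3,4)]
  by (simp add: convolution_H_eq assms)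

lemma H_module_two_local_unit:
  assumes M: "groupoid_module H M"
    and e: "e \<in> carrier (groupoid_ring H)" "e' \<in> carrier (groupoid_ring H)"
    and x: "x \<in> carrier M" "y \<in> carrier M" "e \<odot>\<^bsub>M\<^esub> x = x" "e' \<odot>\<^bsub>M\<^esub> y = y"
  obtains d where "d \<in> carrier (groupoid_ring H)" "d \<odot>\<^bsub>M\<^esub> x = x" "d \<odot>\<^bsub>M\<^esub> y = y"
proof -
  obtain d where d: "d \<in> carrier (groupoid_ring H)" "convolution G d e = e" "convolution G d e' = e'"
    using ring_H_left_unit[OF e] by blast
  have "d \<odot>\<^bsub>M\<^esub> x = x" "d \<odot>\<^bsub>M\<^esub> y = y"
    using H_module_assoc[OF M d(1) e(1) x(1)] H_module_assoc[OF M d(1) e(2) x(2)] d x by simp_all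
  then show thesis using that d by blast
qed

text \<open>An element of the form \<open>a \<odot> y\<close> is fixed by any left unit of \<open>a\<close>, and a common left unit of two local
  units fixes what either of them fixes; this passes to the generated group, which is the whole module.\<close>

lemma H_module_local_unit:
  assumes M: "groupoid_module H M" and x: "x \<in> carrier M"
  obtains e where "e \<in> carrier (groupoid_ring H)" "e \<odot>\<^bsub>M\<^esub> x = x"
proof -
  interpret nd_module "groupoid_ring H" M using M by (rule nd_module.intro)
  have "x \<in> generate (add_monoid M) {a \<odot>\<^bsub>M\<^esub> x | a x. a \<in> carrier (groupoid_ring H) \<and> x \<in> carrier M}"
    using x span unfolding action_span_def by simp
  then have "x \<in> carrier M \<and> (\<exists>e\<in>carrier (groupoid_ring H). e \<odot>\<^bsub>M\<^esub> x = x)"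
  proof (induction rule: generate.induct)
    case one
    have "(\<lambda>_. 0) \<in> carrier (groupoid_ring H)"
      unfolding carrier_ring_H using pointwise_subgroup(1)[OF subgroup_int_functions] .
    moreover from this have "(\<lambda>_. 0) \<odot>\<^bsub>M\<^esub> \<zero>\<^bsub>M\<^esub> = \<zero>\<^bsub>M\<^esub>"
      using smult_add_right[of "\<lambda>_. 0" "\<zero>\<^bsub>M\<^esub>" "\<zero>\<^bsub>M\<^esub>"] smult_closed[of "\<lambda>_. 0" "\<zero>\<^bsub>M\<^esub>"] by simp
    ultimately show ?case by auto
  next
    case (incl h)
    then obtain a y where a: "a \<in> carrier (groupoid_ring H)" "y \<in> carrier M" "h = a \<odot>\<^bsub>M\<^esub> y" by blast
    obtain e where e: "e \<in> carrier (groupoid_ring H)" "convolution G e a = a"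
      using ring_H_left_unit[OF a(1) a(1)] by blast
    then have "e \<odot>\<^bsub>M\<^esub> h = h" using H_module_assoc[OF M e(1) a(1,2)] a by simp
    then show ?case using e a by (intro conjI bexI[of _ e]) simp_all
  next
    case (inv h)
    then obtain a y where a: "a \<in> carrier (groupoid_ring H)" "y \<in> carrier M" "h = a \<odot>\<^bsub>M\<^esub> y" by blast
    obtain e where e: "e \<in> carrier (groupoid_ring H)" "convolution G e a = a"
      using ring_H_left_unit[OF a(1) a(1)] by blast
    then have "e \<odot>\<^bsub>M\<^esub> h = h" using H_module_assoc[OF M e(1) a(1,2)] a by simp
    then have "e \<odot>\<^bsub>M\<^esub> (\<ominus>\<^bsub>M\<^esub> h) = \<ominus>\<^bsub>M\<^esub> h" using e a by (simp add: smult_uminus)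
    then show ?case using e a by (auto simp: a_inv_def[symmetric])
  next
    case (eng h1 h2)
    then obtain e e' where "e \<in> carrier (groupoid_ring H)" "e' \<in> carrier (groupoid_ring H)"
      "h1 \<in> carrier M" "h2 \<in> carrier M" "e \<odot>\<^bsub>M\<^esub> h1 = h1" "e' \<odot>\<^bsub>M\<^esub> h2 = h2" by blast
    then obtain d where "d \<in> carrier (groupoid_ring H)" "d \<odot>\<^bsub>M\<^esub> h1 = h1" "d \<odot>\<^bsub>M\<^esub> h2 = h2"
      using H_module_two_local_unit[OF M] by metis
    then show ?case using \<open>h1 \<in> carrier M\<close> \<open>h2 \<in> carrier M\<close>
      by (auto simp: smult_add_right intro!: bexI[of _ d])
  qed
  then show thesis using that by blast
qed

lemma H_module_common_local_unit:
  assumes M: "groupoid_module H M" and x: "x \<in> carrier M" "y \<in> carrier M"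
  obtains e where "e \<in> carrier (groupoid_ring H)" "e \<odot>\<^bsub>M\<^esub> x = x" "e \<odot>\<^bsub>M\<^esub> y = y"
  using H_module_local_unit[OF M x(1)] H_module_local_unit[OF M x(2)] H_module_two_local_unit[OF M _ _ x]
  by metis

section \<open>Restriction\<close>

lemma ring_H_in_ring_G: "\<xi> \<in> carrier (groupoid_ring H) \<Longrightarrow> \<xi> \<in> carrier (groupoid_ring G)"
  by simp

lemma res_module_simps [simp]:
  "add (res_module H N) = add N" "ring.zero (res_module H N) = ring.zero N" "smult (res_module H N) = smult N"
  by (simp_all add: res_module_def)

lemma carrier_res_module:
  "carrier (res_module H N)
    = generate (add_monoid N) {a \<odot>\<^bsub>N\<^esub> x | a x. a \<in> carrier (groupoid_ring H) \<and> x \<in> carrier N}"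
  by (simp add: res_module_def action_span_def)

lemma smult_in_res_module:
  "a \<in> carrier (groupoid_ring H) \<Longrightarrow> x \<in> carrier N \<Longrightarrow> a \<odot>\<^bsub>N\<^esub> x \<in> carrier (res_module H N)"
  unfolding carrier_res_module by (rule generate.incl) blast

lemma subgroup_res_module:
  assumes N: "groupoid_module G N"
  shows "subgroup (carrier (res_module H N)) (add_monoid N)"
proof -
  interpret nd_module "groupoid_ring G" N using N by (rule nd_module.intro)
  show ?thesis
    unfolding carrier_res_module using ring_H_in_ring_G by (intro add.generate_is_subgroup) auto
qed

lemma res_module_subset:
  assumes "groupoid_module G N" "x \<in> carrier (res_module H N)"
  shows "x \<in> carrier N"
  using subgroup.subset[OF subgroup_res_module[OF assms(1)]] assms(2) by auto

text \<open>Only non-degeneracy is at stake. With a left unit \<open>e\<close> of \<open>a\<close>, the generator \<open>a \<odot> x\<close> equals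
  \<open>e \<odot> (a \<odot> x)\<close>, so the elements \<open>a \<odot> x\<close> with \<open>x\<close> in the restricted module are all the generators.\<close>

lemma groupoid_module_res:
  assumes N: "groupoid_module G N"
  shows "groupoid_module H (res_module H N)"
proof -
  interpret nd_module "groupoid_ring G" N using N by (rule nd_module.intro)
  note sub = subgroup_res_module[OF N]
  note inN = res_module_subset[OF N]
  have am: "add_monoid (res_module H N) = (add_monoid N)\<lparr>carrier := carrier (res_module H N)\<rparr>"
    by simp
  have "group (add_monoid (res_module H N))"
    unfolding am by (rule add.subgroup_imp_group[OF sub])
  then have "comm_group (add_monoid (res_module H N))"
    by (rule group.group_comm_groupI) (auto intro: a_comm inN)
  then have ab: "abelian_group (res_module H N)" by (rule comm_group_abelian_groupI)
  let ?X = "{a \<odot>\<^bsub>N\<^esub> x | a x. a \<in> carrier (groupoid_ring H) \<and> x \<in> carrier (res_module H N)}"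
  have X: "?X = {a \<odot>\<^bsub>N\<^esub> x | a x. a \<in> carrier (groupoid_ring H) \<and> x \<in> carrier N}"
  proof (intro subset_antisym subsetI)
    fix y assume "y \<in> {a \<odot>\<^bsub>N\<^esub> x | a x. a \<in> carrier (groupoid_ring H) \<and> x \<in> carrier N}"
    then obtain a x where a: "y = a \<odot>\<^bsub>N\<^esub> x" "a \<in> carrier (groupoid_ring H)" "x \<in> carrier N" by blast
    obtain e where e: "e \<in> carrier (groupoid_ring H)" "convolution G e a = a"
      using ring_H_left_unit[OF a(2) a(2)] by blast
    then have "y = e \<odot>\<^bsub>N\<^esub> (a \<odot>\<^bsub>N\<^esub> x)"
      using smult_assoc[of e a x] a ring_H_in_ring_G by simp
    then show "y \<in> ?X" using e smult_in_res_module[OF a(2,3)] by blast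
  qed (use inN in blast)
  have "action_span (groupoid_ring H) (res_module H N) = carrier (res_module H N)"
  proof -
    have "?X \<subseteq> carrier (res_module H N)" using smult_in_res_module[of _ _ N] inN by blast
    from add.generate_consistent[OF this sub]
    have "generate (add_monoid (res_module H N)) ?X = generate (add_monoid N) ?X"
      unfolding am by simp
    then show ?thesis
      unfolding action_span_def by (simp only: res_module_simps X carrier_res_module[symmetric])
  qed
  then show ?thesis
    unfolding nondegenerate_module_def using ab
    by (auto simp: smult_in_res_module inN smult_add_left[simplified] smult_add_right
        convolution_H_eq smult_assoc[simplified])
qed

lemma module_map_res:
  assumes N: "groupoid_module G N" "groupoid_module G N'" and f: "f \<in> groupoid_maps G N N'"
    and x: "x \<in> carrier (res_module H N)"
  shows "f x \<in> carrier (res_module H N')"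
proof -
  obtain e where e: "e \<in> carrier (groupoid_ring H)" "e \<odot>\<^bsub>N\<^esub> x = x"
    using H_module_local_unit[OF groupoid_module_res[OF N(1)] x] by auto
  have "f x = e \<odot>\<^bsub>N'\<^esub> f x"
    using module_maps_smult[OF f, of e x] e res_module_subset[OF N(1) x] by simp
  then show ?thesis
    using smult_in_res_module[OF e(1), of "f x" N'] module_maps_closed[OF f] res_module_subset[OF N(1) x] by simp
qed

lemma res_map_eq: "x \<in> carrier (res_module H N) \<Longrightarrow> res_map H N f x = f x"
  by (simp add: res_map_def)

lemma res_map_module_map:
  assumes N: "groupoid_module G N" "groupoid_module G N'" and f: "f \<in> groupoid_maps G N N'"
  shows "res_map H N f \<in> groupoid_maps H (res_module H N) (res_module H N')"
proof -
  interpret res: nd_module "groupoid_ring H" "res_module H N"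
    using groupoid_module_res[OF N(1)] by (rule nd_module.intro)
  note inN = res_module_subset[OF N(1)]
  show ?thesis
    unfolding module_maps_def
    using module_map_res[OF N f] res.a_closed res.smult_closed module_maps_add[OF f] module_maps_smult[OF f] inN
    by (auto simp: res_map_eq)
qed

end

context ample_open_subgroupoid
begin

section \<open>Induction\<close>

abbreviation ind_group :: "('g \<Rightarrow> int, 'm) module \<Rightarrow> ('g, 'm) ind monoid"
  where "ind_group M \<equiv> tensor_group (groupoid_ring H) (ind_bimodule G H) (convolution G) M"

lemma tensor_data_ind:
  assumes "groupoid_module H M"
  shows "tensor_data (groupoid_ring H) (ind_bimodule G H) (convolution G) M"
proof -
  interpret nd_module "groupoid_ring H" M using assms by (rule nd_module.intro)
  show ?thesis
    by unfold_locales (simp_all add: bimodule_closed_add bimodule_right_closed)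
qed

lemma ind_tensor_eq:
  assumes "groupoid_module H M"
  shows "tensor_data.tensor (groupoid_ring H) (ind_bimodule G H) (convolution G) M \<xi> m
    = ind_tensor G H M \<xi> m"
  by (simp add: tensor_data.tensor_def[OF tensor_data_ind[OF assms]] ind_tensor_def)

lemma ind_module_simps [simp]:
  "carrier (ind_module G H M) = carrier (ind_group M)"
  "add (ind_module G H M) = monoid.mult (ind_group M)"
  "ring.zero (ind_module G H M) = \<one>\<^bsub>ind_group M\<^esub>"
  by (simp_all add: ind_module_def Let_def)

lemma ind_smult:
  "smult (ind_module G H M) \<zeta> = tensor_map (groupoid_ring H) (ind_bimodule G H) (convolution G) M
    (\<lambda>(\<xi>, m). (convolution G \<zeta> \<xi>, m))"
  by (simp add: ind_module_def Let_def)

lemma comm_group_ind: 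
  assumes "groupoid_module H M"
  shows "comm_group (ind_group M)"
  by (rule tensor_data.comm_group_T[OF tensor_data_ind[OF assms]])

lemma abelian_group_ind:
  assumes "groupoid_module H M"
  shows "abelian_group (ind_module G H M)"
proof -
  interpret comm_group "ind_group M" by (rule comm_group_ind[OF assms])
  show ?thesis
    by (rule abelian_groupI) (simp_all add: m_ac l_inv_ex)
qed

lemma ind_tensor_closed [simp]:
  "groupoid_module H M \<Longrightarrow> \<xi> \<in> carrier (ind_bimodule G H) \<Longrightarrow> m \<in> carrier M \<Longrightarrow>
    ind_tensor G H M \<xi> m \<in> carrier (ind_group M)"
  using tensor_data.tensor_closed[OF tensor_data_ind, of M \<xi> m] by (simp add: ind_tensor_eq)

lemma ind_tensor_add_left:
  "groupoid_module H M \<Longrightarrow> \<xi> \<in> carrier (ind_bimodule G H) \<Longrightarrow> \<xi>' \<in> carrier (ind_bimodule G H) \<Longrightarrow>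
    m \<in> carrier M \<Longrightarrow> ind_tensor G H M (\<lambda>g. \<xi> g + \<xi>' g) m
      = ind_tensor G H M \<xi> m \<otimes>\<^bsub>ind_group M\<^esub> ind_tensor G H M \<xi>' m"
  using tensor_data.tensor_add_left[OF tensor_data_ind, of M \<xi> \<xi>' m] by (simp add: ind_tensor_eq)

lemma ind_tensor_add_right:
  "groupoid_module H M \<Longrightarrow> \<xi> \<in> carrier (ind_bimodule G H) \<Longrightarrow> m \<in> carrier M \<Longrightarrow> m' \<in> carrier M \<Longrightarrow>
    ind_tensor G H M \<xi> (m \<oplus>\<^bsub>M\<^esub> m')
      = ind_tensor G H M \<xi> m \<otimes>\<^bsub>ind_group M\<^esub> ind_tensor G H M \<xi> m'"
  using tensor_data.tensor_add_right[OF tensor_data_ind, of M \<xi> m m'] by (simp add: ind_tensor_eq)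

lemma ind_tensor_balanced:
  "groupoid_module H M \<Longrightarrow> \<xi> \<in> carrier (ind_bimodule G H) \<Longrightarrow> \<zeta> \<in> carrier (groupoid_ring H) \<Longrightarrow>
    m \<in> carrier M \<Longrightarrow> ind_tensor G H M (convolution G \<xi> \<zeta>) m = ind_tensor G H M \<xi> (\<zeta> \<odot>\<^bsub>M\<^esub> m)"
  using tensor_data.tensor_balanced[OF tensor_data_ind, of M \<xi> \<zeta> m] by (simp add: ind_tensor_eq)

lemma ind_hom_eqI:
  assumes M: "groupoid_module H M" and "f \<in> hom (ind_group M) K" "g \<in> hom (ind_group M) K" "group K"
    and "\<And>\<xi> m. \<xi> \<in> carrier (ind_bimodule G H) \<Longrightarrow> m \<in> carrier M \<Longrightarrow>
      f (ind_tensor G H M \<xi> m) = g (ind_tensor G H M \<xi> m)"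
    and "t \<in> carrier (ind_group M)"
  shows "f t = g t"
  by (rule tensor_data.T_hom_eqI[OF tensor_data_ind[OF M] assms(2-4) _ assms(6)])
    (use assms in \<open>simp add: ind_tensor_eq\<close>)

text \<open>The common construction of the action on an induced module (\<open>\<alpha>\<close> a left multiplication, \<open>f\<close> the identity)
  and of induced maps (\<open>\<alpha>\<close> the identity).\<close>

lemma ind_tensor_map:
  assumes M: "groupoid_module H M" and M': "groupoid_module H M'"
    and \<phi>: "\<And>\<xi> m. \<xi> \<in> carrier (ind_bimodule G H) \<Longrightarrow> m \<in> carrier M \<Longrightarrow>
      \<alpha> \<xi> \<in> carrier (ind_bimodule G H) \<and> f m \<in> carrier M'"
    and \<alpha>: "\<And>\<xi> \<xi>'. \<xi> \<in> carrier (ind_bimodule G H) \<Longrightarrow> \<xi>' \<in> carrier (ind_bimodule G H) \<Longrightarrow>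
        \<alpha> (\<lambda>g. \<xi> g + \<xi>' g) = (\<lambda>g. \<alpha> \<xi> g + \<alpha> \<xi>' g)"
      "\<And>\<xi> \<zeta>. \<xi> \<in> carrier (ind_bimodule G H) \<Longrightarrow> \<zeta> \<in> carrier (groupoid_ring H) \<Longrightarrow>
        \<alpha> (convolution G \<xi> \<zeta>) = convolution G (\<alpha> \<xi>) \<zeta>"
    and f: "\<And>m m'. m \<in> carrier M \<Longrightarrow> m' \<in> carrier M \<Longrightarrow> f (m \<oplus>\<^bsub>M\<^esub> m') = f m \<oplus>\<^bsub>M'\<^esub> f m'"
      "\<And>\<zeta> m. \<zeta> \<in> carrier (groupoid_ring H) \<Longrightarrow> m \<in> carrier M \<Longrightarrow> f (\<zeta> \<odot>\<^bsub>M\<^esub> m) = \<zeta> \<odot>\<^bsub>M'\<^esub> f m"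
  shows "tensor_map (groupoid_ring H) (ind_bimodule G H) (convolution G) M' (\<lambda>(\<xi>, m). (\<alpha> \<xi>, f m))
      \<in> hom (ind_group M) (ind_group M')"
    and "\<And>\<xi> m. \<xi> \<in> carrier (ind_bimodule G H) \<Longrightarrow> m \<in> carrier M \<Longrightarrow>
      tensor_map (groupoid_ring H) (ind_bimodule G H) (convolution G) M' (\<lambda>(\<xi>, m). (\<alpha> \<xi>, f m))
        (ind_tensor G H M \<xi> m) = ind_tensor G H M' (\<alpha> \<xi>) (f m)"
proof -
  have t: "tensor_coset (groupoid_ring H) (ind_bimodule G H) (convolution G) M'
      (frag_of (case (\<xi>, m) of (\<xi>, m) \<Rightarrow> (\<alpha> \<xi>, f m))) = ind_tensor G H M' (\<alpha> \<xi>) (f m)" for \<xi> m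
    by (simp add: ind_tensor_def)
  have bal: "tensor_data.balanced (groupoid_ring H) (ind_bimodule G H) (convolution G) M (ind_group M')
    (\<lambda>\<xi> m. tensor_coset (groupoid_ring H) (ind_bimodule G H) (convolution G) M'
      (frag_of (case (\<xi>, m) of (\<xi>, m) \<Rightarrow> (\<alpha> \<xi>, f m))))"
    unfolding tensor_data.balanced_def[OF tensor_data_ind[OF M]] t
    using M' \<phi> by (simp add: \<alpha> f ind_tensor_add_left ind_tensor_add_right ind_tensor_balanced)
  note map = tensor_map_coset[OF tensor_data_ind[OF M] tensor_data_ind[OF M'] _ bal]
  show "tensor_map (groupoid_ring H) (ind_bimodule G H) (convolution G) M' (\<lambda>(\<xi>, m). (\<alpha> \<xi>, f m))
      \<in> hom (ind_group M) (ind_group M')"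
    by (rule map(1)) (use \<phi> in auto)
  show "tensor_map (groupoid_ring H) (ind_bimodule G H) (convolution G) M' (\<lambda>(\<xi>, m). (\<alpha> \<xi>, f m))
        (ind_tensor G H M \<xi> m) = ind_tensor G H M' (\<alpha> \<xi>) (f m)"
    if "\<xi> \<in> carrier (ind_bimodule G H)" "m \<in> carrier M" for \<xi> m
    using map(2)[OF _ that] \<phi> by (simp add: ind_tensor_def)
qed

lemma ind_smult_hom:
  assumes M: "groupoid_module H M" and \<zeta>: "\<zeta> \<in> carrier (groupoid_ring G)"
  shows "smult (ind_module G H M) \<zeta> \<in> hom (ind_group M) (ind_group M)"
    and "\<And>\<xi> m. \<xi> \<in> carrier (ind_bimodule G H) \<Longrightarrow> m \<in> carrier M \<Longrightarrow>
      \<zeta> \<odot>\<^bsub>ind_module G H M\<^esub> ind_tensor G H M \<xi> m = ind_tensor G H M (convolution G \<zeta> \<xi>) m"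
  unfolding ind_smult
  by (rule ind_tensor_map[OF M M, where f = "\<lambda>m. m"];
      use \<zeta> bimodule_left_closed in \<open>simp add: conv_add_right conv_assoc\<close>)+

lemma ind_map_hom:
  assumes M: "groupoid_module H M" and M': "groupoid_module H M'" and f: "f \<in> groupoid_maps H M M'"
  shows "ind_map G H M' f \<in> hom (ind_group M) (ind_group M')"
    and "\<And>\<xi> m. \<xi> \<in> carrier (ind_bimodule G H) \<Longrightarrow> m \<in> carrier M \<Longrightarrow>
      ind_map G H M' f (ind_tensor G H M \<xi> m) = ind_tensor G H M' \<xi> (f m)"
  unfolding ind_map_def
  by (rule ind_tensor_map[OF M M', where \<alpha> = "\<lambda>\<xi>. \<xi>"];
      use f in \<open>simp add: module_maps_closed module_maps_add module_maps_smult\<close>)+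

text \<open>Both sides of each module law are additive in \<open>t\<close>, so the law reduces to one of the convolution. For
  non-degeneracy, a left unit \<open>e\<close> of \<open>\<xi>\<close> gives \<open>\<xi> \<otimes> m = e \<odot> (\<xi> \<otimes> m)\<close>.\<close>

lemma groupoid_module_ind:
  assumes M: "groupoid_module H M"
  shows "groupoid_module G (ind_module G H M)"
proof -
  let ?I = "ind_module G H M"
  interpret T: comm_group "ind_group M" by (rule comm_group_ind[OF M])
  note act = ind_smult_hom[OF M]
  have cl: "\<zeta> \<odot>\<^bsub>?I\<^esub> t \<in> carrier (ind_group M)"
    if "\<zeta> \<in> carrier (groupoid_ring G)" "t \<in> carrier (ind_group M)" for \<zeta> t
    using hom_in_carrier[OF act(1)[OF that(1)] that(2)] .
  have add_left: "(\<lambda>g. \<zeta> g + \<zeta>' g) \<odot>\<^bsub>?I\<^esub> t = (\<zeta> \<odot>\<^bsub>?I\<^esub> t) \<otimes>\<^bsub>ind_group M\<^esub> (\<zeta>' \<odot>\<^bsub>?I\<^esub> t)"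
    if z: "\<zeta> \<in> carrier (groupoid_ring G)" "\<zeta>' \<in> carrier (groupoid_ring G)"
      and t: "t \<in> carrier (ind_group M)" for \<zeta> \<zeta>' t
  proof (rule ind_hom_eqI[OF M act(1)[OF ring_G_closed_add[OF z]] _ T.is_group _ t])
    show "(\<lambda>t. (\<zeta> \<odot>\<^bsub>?I\<^esub> t) \<otimes>\<^bsub>ind_group M\<^esub> (\<zeta>' \<odot>\<^bsub>?I\<^esub> t)) \<in> hom (ind_group M) (ind_group M)"
      using hom_mult[OF act(1)[OF z(1)]] hom_mult[OF act(1)[OF z(2)]] cl z
      by (auto intro!: homI simp: T.m_ac)
    show "(\<lambda>g. \<zeta> g + \<zeta>' g) \<odot>\<^bsub>?I\<^esub> ind_tensor G H M \<xi> m
        = (\<zeta> \<odot>\<^bsub>?I\<^esub> ind_tensor G H M \<xi> m) \<otimes>\<^bsub>ind_group M\<^esub> (\<zeta>' \<odot>\<^bsub>?I\<^esub> ind_tensor G H M \<xi> m)"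
      if "\<xi> \<in> carrier (ind_bimodule G H)" "m \<in> carrier M" for \<xi> m
      using that z M by (simp add: act(2) ring_G_closed_add conv_add_left ind_tensor_add_left bimodule_left_closed)
  qed
  have assoc: "convolution G \<zeta> \<zeta>' \<odot>\<^bsub>?I\<^esub> t = \<zeta> \<odot>\<^bsub>?I\<^esub> (\<zeta>' \<odot>\<^bsub>?I\<^esub> t)"
    if z: "\<zeta> \<in> carrier (groupoid_ring G)" "\<zeta>' \<in> carrier (groupoid_ring G)"
      and t: "t \<in> carrier (ind_group M)" for \<zeta> \<zeta>' t
  proof (rule ind_hom_eqI[OF M act(1)[OF ring_G_closed_mult[OF z]] _ T.is_group _ t])
    show "(\<lambda>t. \<zeta> \<odot>\<^bsub>?I\<^esub> (\<zeta>' \<odot>\<^bsub>?I\<^esub> t)) \<in> hom (ind_group M) (ind_group M)"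
      using hom_compose[OF act(1)[OF z(2)] act(1)[OF z(1)]] by (simp add: o_def)
    show "convolution G \<zeta> \<zeta>' \<odot>\<^bsub>?I\<^esub> ind_tensor G H M \<xi> m = \<zeta> \<odot>\<^bsub>?I\<^esub> (\<zeta>' \<odot>\<^bsub>?I\<^esub> ind_tensor G H M \<xi> m)"
      if "\<xi> \<in> carrier (ind_bimodule G H)" "m \<in> carrier M" for \<xi> m
      using that z by (simp add: act(2) ring_G_closed_mult conv_assoc bimodule_left_closed)
  qed
  have span: "action_span (groupoid_ring G) ?I = carrier (ind_group M)"
  proof
    let ?X = "{a \<odot>\<^bsub>?I\<^esub> t | a t. a \<in> carrier (groupoid_ring G) \<and> t \<in> carrier ?I}"
    let ?Y = "{tensor_data.tensor (groupoid_ring H) (ind_bimodule G H) (convolution G) M \<xi> m | \<xi> m.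
      \<xi> \<in> carrier (ind_bimodule G H) \<and> m \<in> carrier M}"
    have gen: "action_span (groupoid_ring G) ?I = generate (ind_group M) ?X"
      unfolding action_span_def by (rule generate_cong_operations) simp_all
    show "action_span (groupoid_ring G) ?I \<subseteq> carrier (ind_group M)"
      unfolding gen by (rule T.generate_incl) (use cl in auto)
    have "?Y \<subseteq> ?X"
    proof clarify
      fix \<xi> m assume x: "\<xi> \<in> carrier (ind_bimodule G H)" "m \<in> carrier M"
      obtain e where "e \<in> carrier (groupoid_ring G)" "convolution G e \<xi> = \<xi>"
        using bimodule_left_unit[OF x(1)] by blast
      then have "ind_tensor G H M \<xi> m = e \<odot>\<^bsub>?I\<^esub> ind_tensor G H M \<xi> m"
        using act(2)[of e \<xi> m] x by simp
      then show "\<exists>a t. tensor_data.tensor (groupoid_ring H) (ind_bimodule G H) (convolution G) M \<xi> m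
          = a \<odot>\<^bsub>?I\<^esub> t \<and> a \<in> carrier (groupoid_ring G) \<and> t \<in> carrier ?I"
        using \<open>e \<in> carrier (groupoid_ring G)\<close> x M
        by (intro exI[of _ e] exI[of _ "ind_tensor G H M \<xi> m"]) (simp add: ind_tensor_eq)
    qed
    then show "carrier (ind_group M) \<subseteq> action_span (groupoid_ring G) ?I"
      unfolding gen tensor_data.carrier_T_generate[OF tensor_data_ind[OF M]]
      by (rule T.mono_generate)
  qed
  show ?thesis
    unfolding nondegenerate_module_def
    using abelian_group_ind[OF M] cl add_left assoc span hom_mult[OF act(1)] by simp
qed

lemma ind_map_module_map:
  assumes M: "groupoid_module H M" and M': "groupoid_module H M'" and f: "f \<in> groupoid_maps H M M'"
  shows "ind_map G H M' f \<in> groupoid_maps G (ind_module G H M) (ind_module G H M')"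
proof (rule module_mapsI)
  note map = ind_map_hom[OF M M' f]
  show "ind_map G H M' f \<in> hom (add_monoid (ind_module G H M)) (add_monoid (ind_module G H M'))"
    using map(1) by (simp add: hom_def)
  fix \<zeta> t assume z: "\<zeta> \<in> carrier (groupoid_ring G)" and t: "t \<in> carrier (ind_module G H M)"
  show "ind_map G H M' f (\<zeta> \<odot>\<^bsub>ind_module G H M\<^esub> t) = \<zeta> \<odot>\<^bsub>ind_module G H M'\<^esub> ind_map G H M' f t"
  proof (rule ind_hom_eqI[OF M])
    show "(\<lambda>t. ind_map G H M' f (\<zeta> \<odot>\<^bsub>ind_module G H M\<^esub> t)) \<in> hom (ind_group M) (ind_group M')"
      using hom_compose[OF ind_smult_hom(1)[OF M z] map(1)] by (simp add: o_def)
    show "(\<lambda>t. \<zeta> \<odot>\<^bsub>ind_module G H M'\<^esub> ind_map G H M' f t) \<in> hom (ind_group M) (ind_group M')"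
      using hom_compose[OF map(1) ind_smult_hom(1)[OF M' z]] by (simp add: o_def)
    show "group (ind_group M')" using comm_group_ind[OF M'] by (rule comm_group.axioms(2))
    show "t \<in> carrier (ind_group M)" using t by simp
    show "ind_map G H M' f (\<zeta> \<odot>\<^bsub>ind_module G H M\<^esub> ind_tensor G H M \<xi> m)
        = \<zeta> \<odot>\<^bsub>ind_module G H M'\<^esub> ind_map G H M' f (ind_tensor G H M \<xi> m)"
      if "\<xi> \<in> carrier (ind_bimodule G H)" "m \<in> carrier M" for \<xi> m
      using that z module_maps_closed[OF f]
      by (simp add: map(2) ind_smult_hom(2)[OF M] ind_smult_hom(2)[OF M'] bimodule_left_closed)
  qed
qed

lemma module_maps_id: "(\<lambda>m. m) \<in> module_maps R M M"
  by (simp add: module_maps_def)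

lemma module_maps_compose:
  "f \<in> module_maps R M M' \<Longrightarrow> f' \<in> module_maps R M' M'' \<Longrightarrow> (\<lambda>m. f' (f m)) \<in> module_maps R M M''"
  by (auto simp: module_maps_def Pi_iff)

lemma ind_map_id:
  assumes M: "groupoid_module H M" and t: "t \<in> carrier (ind_group M)"
  shows "ind_map G H M (\<lambda>m. m) t = t"
proof (rule ind_hom_eqI[OF M _ _ _ _ t])
  show "ind_map G H M (\<lambda>m. m) \<in> hom (ind_group M) (ind_group M)"
    by (rule ind_map_hom(1)[OF M M module_maps_id])
  show "(\<lambda>t. t) \<in> hom (ind_group M) (ind_group M)" by (simp add: hom_def)
  show "group (ind_group M)" using comm_group_ind[OF M] by (rule comm_group.axioms(2))
qed (simp add: ind_map_hom(2)[OF M M module_maps_id])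

lemma ind_map_compose:
  assumes M: "groupoid_module H M" "groupoid_module H M'" "groupoid_module H M''"
    and f: "f \<in> groupoid_maps H M M'" "f' \<in> groupoid_maps H M' M''" and t: "t \<in> carrier (ind_group M)"
  shows "ind_map G H M'' (\<lambda>m. f' (f m)) t = ind_map G H M'' f' (ind_map G H M' f t)"
proof (rule ind_hom_eqI[OF M(1) _ _ _ _ t])
  show "ind_map G H M'' (\<lambda>m. f' (f m)) \<in> hom (ind_group M) (ind_group M'')"
    by (rule ind_map_hom(1)[OF M(1,3) module_maps_compose[OF f]])
  show "(\<lambda>t. ind_map G H M'' f' (ind_map G H M' f t)) \<in> hom (ind_group M) (ind_group M'')"
    using hom_compose[OF ind_map_hom(1)[OF M(1,2) f(1)] ind_map_hom(1)[OF M(2,3) f(2)]]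
    by (simp add: o_def)
  show "group (ind_group M'')" using comm_group_ind[OF M(3)] by (rule comm_group.axioms(2))
qed (use module_maps_closed[OF f(1)] in \<open>simp add: ind_map_hom(2)[OF M(1,3) module_maps_compose[OF f]]
    ind_map_hom(2)[OF M(1,2) f(1)] ind_map_hom(2)[OF M(2,3) f(2)]\<close>)

section \<open>The unit\<close>

text \<open>If \<open>\<zeta> \<odot> m = \<zeta>' \<odot> m'\<close> and \<open>e\<close> is a left unit of \<open>\<zeta>\<close> and \<open>\<zeta>'\<close>, then
  \<open>\<zeta> \<otimes> m = e \<otimes> \<zeta> \<odot> m = e \<otimes> \<zeta>' \<odot> m' = \<zeta>' \<otimes> m'\<close>. So the value of the unit does not depend on
  the factorisation.\<close>

lemma ind_res_unit_tensor:
  assumes M: "groupoid_module H M" and \<zeta>: "\<zeta> \<in> carrier (groupoid_ring H)" and m: "m \<in> carrier M"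
  shows "ind_res_unit G H M (\<zeta> \<odot>\<^bsub>M\<^esub> m) = ind_tensor G H M \<zeta> m"
  unfolding ind_res_unit_def
proof (rule the_equality)
  show "\<exists>\<zeta>'\<in>carrier (groupoid_ring H). \<exists>m'\<in>carrier M.
      \<zeta> \<odot>\<^bsub>M\<^esub> m = \<zeta>' \<odot>\<^bsub>M\<^esub> m' \<and> ind_tensor G H M \<zeta> m = ind_tensor G H M \<zeta>' m'"
    using \<zeta> m by blast
  fix t assume "\<exists>\<zeta>'\<in>carrier (groupoid_ring H). \<exists>m'\<in>carrier M.
      \<zeta> \<odot>\<^bsub>M\<^esub> m = \<zeta>' \<odot>\<^bsub>M\<^esub> m' \<and> t = ind_tensor G H M \<zeta>' m'"
  then obtain \<zeta>' m' where t: "\<zeta>' \<in> carrier (groupoid_ring H)" "m' \<in> carrier M"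
    "\<zeta> \<odot>\<^bsub>M\<^esub> m = \<zeta>' \<odot>\<^bsub>M\<^esub> m'" "t = ind_tensor G H M \<zeta>' m'" by blast
  obtain e where e: "e \<in> carrier (groupoid_ring H)" "convolution G e \<zeta> = \<zeta>" "convolution G e \<zeta>' = \<zeta>'"
    using ring_H_left_unit[OF \<zeta> t(1)] by blast
  have "t = ind_tensor G H M e (\<zeta>' \<odot>\<^bsub>M\<^esub> m')"
    using ind_tensor_balanced[OF M ring_H_in_bimodule[OF e(1)] t(1,2)] e t(4) by simp
  also have "\<dots> = ind_tensor G H M e (\<zeta> \<odot>\<^bsub>M\<^esub> m)" using t by simp
  also have "\<dots> = ind_tensor G H M \<zeta> m"
    using ind_tensor_balanced[OF M ring_H_in_bimodule[OF e(1)] \<zeta> m] e by simp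
  finally show "t = ind_tensor G H M \<zeta> m" .
qed

text \<open>The working description of the unit: \<open>x\<close> goes to \<open>e \<otimes> x\<close> for any \<open>e\<close> that fixes \<open>x\<close>. Additivity
  and naturality follow by choosing \<open>e\<close> for all elements involved.\<close>

lemma ind_res_unit_local_unit:
  assumes M: "groupoid_module H M" and e: "e \<in> carrier (groupoid_ring H)" and x: "x \<in> carrier M" "e \<odot>\<^bsub>M\<^esub> x = x"
  shows "ind_res_unit G H M x = ind_tensor G H M e x"
  using ind_res_unit_tensor[OF M e x(1)] x(2) by simp

lemma ind_tensor_in_res:
  assumes M: "groupoid_module H M" and \<zeta>: "\<zeta> \<in> carrier (groupoid_ring H)" and m: "m \<in> carrier M"
  shows "ind_tensor G H M \<zeta> m \<in> carrier (res_module H (ind_module G H M))"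
proof -
  obtain e where e: "e \<in> carrier (groupoid_ring H)" "convolution G e \<zeta> = \<zeta>"
    using ring_H_left_unit[OF \<zeta> \<zeta>] by blast
  have "e \<odot>\<^bsub>ind_module G H M\<^esub> ind_tensor G H M \<zeta> m \<in> carrier (res_module H (ind_module G H M))"
    using M \<zeta> m by (intro smult_in_res_module[OF e(1)]) simp
  then show ?thesis
    using ind_smult_hom(2)[OF M ring_H_in_ring_G[OF e(1)] ring_H_in_bimodule[OF \<zeta>] m] e by simp
qed

lemma ind_res_unit_module_map:
  assumes M: "groupoid_module H M"
  shows "ind_res_unit G H M \<in> groupoid_maps H M (res_module H (ind_module G H M))"
proof -
  interpret nd_module "groupoid_ring H" M using M by (rule nd_module.intro)
  let ?u = "ind_res_unit G H M" and ?R = "res_module H (ind_module G H M)"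
  have closed: "?u x \<in> carrier ?R" if x: "x \<in> carrier M" for x
  proof -
    obtain e where e: "e \<in> carrier (groupoid_ring H)" "e \<odot>\<^bsub>M\<^esub> x = x"
      using H_module_local_unit[OF M x] by blast
    then show ?thesis
      using ind_res_unit_local_unit[OF M e(1) x e(2)] ind_tensor_in_res[OF M e(1) x] by simp
  qed
  have add: "?u (x \<oplus>\<^bsub>M\<^esub> y) = ?u x \<oplus>\<^bsub>?R\<^esub> ?u y" if x: "x \<in> carrier M" "y \<in> carrier M" for x y
  proof -
    obtain e where e: "e \<in> carrier (groupoid_ring H)" "e \<odot>\<^bsub>M\<^esub> x = x" "e \<odot>\<^bsub>M\<^esub> y = y"
      using H_module_common_local_unit[OF M x] by blast
    then show ?thesis
      using x M by (simp add: ind_res_unit_local_unit[OF M e(1)] smult_add_right ind_tensor_add_right)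
  qed
  have smult: "?u (a \<odot>\<^bsub>M\<^esub> x) = a \<odot>\<^bsub>?R\<^esub> ?u x"
    if a: "a \<in> carrier (groupoid_ring H)" and x: "x \<in> carrier M" for a x
  proof -
    obtain e where e: "e \<in> carrier (groupoid_ring H)" "e \<odot>\<^bsub>M\<^esub> x = x"
      using H_module_local_unit[OF M x] by blast
    have "a \<odot>\<^bsub>?R\<^esub> ?u x = ind_tensor G H M (convolution G a e) x"
      using ind_smult_hom(2)[OF M, of a e x] a x e ind_res_unit_local_unit[OF M e(1) x e(2)] by simp
    also have "\<dots> = ind_tensor G H M a x"
      using ind_tensor_balanced[OF M ring_H_in_bimodule[OF a] e(1) x] e(2) by simp
    finally show ?thesis using ind_res_unit_tensor[OF M a x] by simp
  qed
  show ?thesis using closed add smult by (simp add: module_maps_def)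
qed

lemma ind_res_unit_natural:
  assumes M: "groupoid_module H M" "groupoid_module H M'" and f: "f \<in> groupoid_maps H M M'"
    and x: "x \<in> carrier M"
  shows "ind_res_unit G H M' (f x) = res_map H (ind_module G H M) (ind_map G H M' f) (ind_res_unit G H M x)"
proof -
  obtain e where e: "e \<in> carrier (groupoid_ring H)" "e \<odot>\<^bsub>M\<^esub> x = x"
    using H_module_local_unit[OF M(1) x] by blast
  have fx: "f x \<in> carrier M'" "e \<odot>\<^bsub>M'\<^esub> f x = f x"
    using module_maps_closed[OF f x] module_maps_smult[OF f e(1) x] e(2) by simp_all
  have "res_map H (ind_module G H M) (ind_map G H M' f) (ind_res_unit G H M x)
      = ind_map G H M' f (ind_tensor G H M e x)"
    unfolding ind_res_unit_local_unit[OF M(1) e(1) x e(2)]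
    by (rule res_map_eq[OF ind_tensor_in_res[OF M(1) e(1) x]])
  also have "\<dots> = ind_tensor G H M' e (f x)"
    by (rule ind_map_hom(2)[OF M f ring_H_in_bimodule[OF e(1)] x])
  finally show ?thesis using ind_res_unit_local_unit[OF M(2) e(1) fx] by simp
qed

section \<open>The counit\<close>

text \<open>The action of \<open>\<int>[G]\<close> on \<open>N\<close> is balanced over \<open>\<int>[H]\<close>, so the formal sum that defines the counit
  does not depend on the representative of the coset.\<close>

lemma ind_res_counit_hom:
  assumes N: "groupoid_module G N"
  shows "ind_res_counit G H N \<in> hom (ind_group (res_module H N)) (add_monoid N)"
    and "\<And>\<xi> n. \<xi> \<in> carrier (ind_bimodule G H) \<Longrightarrow> n \<in> carrier (res_module H N) \<Longrightarrow>
      ind_res_counit G H N (ind_tensor G H (res_module H N) \<xi> n) = \<xi> \<odot>\<^bsub>N\<^esub> n"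
proof -
  interpret nd_module "groupoid_ring G" N using N by (rule nd_module.intro)
  note R = groupoid_module_res[OF N]
  interpret D: tensor_data "groupoid_ring H" "ind_bimodule G H" "convolution G" "res_module H N"
    by (rule tensor_data_ind[OF R])
  note inN = res_module_subset[OF N]
  define h where "h = (\<lambda>c. finprod (add_monoid N)
      (\<lambda>p. (case p of (\<xi>, n) \<Rightarrow> \<xi> \<odot>\<^bsub>N\<^esub> n) [^]\<^bsub>add_monoid N\<^esub> (Poly_Mapping.lookup c p :: int)) (Poly_Mapping.keys c))"
  have img: "(\<lambda>p. case p of (\<xi>, n) \<Rightarrow> \<xi> \<odot>\<^bsub>N\<^esub> n) ` (carrier (ind_bimodule G H) \<times> carrier (res_module H N))
      \<subseteq> carrier (add_monoid N)"
    using inN by auto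
  have h: "h \<in> hom D.free (add_monoid N)"
    unfolding h_def by (rule comm_group.formal_sum_hom(1)[OF a_comm_group img])
  have h_of: "h (frag_of (\<xi>, n)) = \<xi> \<odot>\<^bsub>N\<^esub> n"
    if "\<xi> \<in> carrier (ind_bimodule G H)" "n \<in> carrier (res_module H N)" for \<xi> n
    unfolding h_def using comm_group.formal_sum_hom(2)[OF a_comm_group img, of "(\<xi>, n)"] that by simp
  have bal: "D.balanced (add_monoid N) (\<lambda>\<xi> n. h (frag_of (\<xi>, n)))"
    unfolding D.balanced_def
    using inN D.add_N D.act_N smult_add_left smult_assoc
    by (simp add: h_of bimodule_closed_add bimodule_right_closed smult_add_right)
  have counit: "ind_res_counit G H N t = h c" if c: "c \<in> carrier D.free" "t = D.coset c" for t c
  proof -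
    have body: "finsum N (\<lambda>(\<xi>, n). add_pow N (Poly_Mapping.lookup d (\<xi>, n)) (\<xi> \<odot>\<^bsub>N\<^esub> n)) (Poly_Mapping.keys d)
        = h d" for d
      unfolding h_def finsum_def add_pow_def by (simp add: case_prod_unfold)
    show ?thesis
      unfolding ind_res_counit_def body
    proof (rule the_equality)
      show "\<exists>d\<in>t. h c = h d" using D.coset_self c by blast
      show "y = h c" if "\<exists>d\<in>t. y = h d" for y
        using that D.balanced_hom_constant_on_coset[OF a_comm_group h bal c(1)] c(2) by blast
    qed
  qed
  interpret h: group_hom D.free "add_monoid N" h
    using h a_group by (simp add: group_hom_def group_hom_axioms_def)
  show "ind_res_counit G H N \<in> hom (ind_group (res_module H N)) (add_monoid N)"
  proof (rule homI)
    fix s assume "s \<in> carrier (ind_group (res_module H N))"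
    then obtain c where "c \<in> carrier D.free" "s = D.coset c"
      unfolding D.carrier_T by blast
    then show "ind_res_counit G H N s \<in> carrier (add_monoid N)"
      using counit h.hom_closed by simp
  next
    fix s t assume "s \<in> carrier (ind_group (res_module H N))" "t \<in> carrier (ind_group (res_module H N))"
    then obtain c d where c: "c \<in> carrier D.free" "s = D.coset c" and d: "d \<in> carrier D.free" "t = D.coset d"
      unfolding D.carrier_T by blast
    have cd: "c + d \<in> carrier D.free" using h.G.m_closed[OF c(1) d(1)] by simp
    have "ind_res_counit G H N (s \<otimes>\<^bsub>ind_group (res_module H N)\<^esub> t) = h (c + d)"
      by (rule counit[OF cd]) (use c d in \<open>simp only: D.coset_add\<close>)
    also have "\<dots> = h c \<otimes>\<^bsub>add_monoid N\<^esub> h d"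
      using h.hom_mult[OF c(1) d(1)] by simp
    finally show "ind_res_counit G H N (s \<otimes>\<^bsub>ind_group (res_module H N)\<^esub> t)
        = ind_res_counit G H N s \<otimes>\<^bsub>add_monoid N\<^esub> ind_res_counit G H N t"
      using counit[OF c] counit[OF d] by simp
  qed
  show "ind_res_counit G H N (ind_tensor G H (res_module H N) \<xi> n) = \<xi> \<odot>\<^bsub>N\<^esub> n"
    if "\<xi> \<in> carrier (ind_bimodule G H)" "n \<in> carrier (res_module H N)" for \<xi> n
    using counit[of "frag_of (\<xi>, n)"] h_of[OF that] that by (simp add: ind_tensor_def)
qed

lemma ind_res_counit_module_map:
  assumes N: "groupoid_module G N"
  shows "ind_res_counit G H N \<in> groupoid_maps G (ind_module G H (res_module H N)) N"
proof (rule module_mapsI)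
  interpret nd_module "groupoid_ring G" N using N by (rule nd_module.intro)
  note R = groupoid_module_res[OF N]
  note counit = ind_res_counit_hom[OF N]
  let ?I = "ind_module G H (res_module H N)"
  show "ind_res_counit G H N \<in> hom (add_monoid ?I) (add_monoid N)"
    using counit(1) by (simp add: hom_def)
  fix \<zeta> t assume z: "\<zeta> \<in> carrier (groupoid_ring G)" and t: "t \<in> carrier ?I"
  show "ind_res_counit G H N (\<zeta> \<odot>\<^bsub>?I\<^esub> t) = \<zeta> \<odot>\<^bsub>N\<^esub> ind_res_counit G H N t"
  proof (rule ind_hom_eqI[OF R _ _ a_group])
    show "(\<lambda>t. ind_res_counit G H N (\<zeta> \<odot>\<^bsub>?I\<^esub> t)) \<in> hom (ind_group (res_module H N)) (add_monoid N)"
      using hom_compose[OF ind_smult_hom(1)[OF R z] counit(1)] by (simp add: o_def)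
    show "(\<lambda>t. \<zeta> \<odot>\<^bsub>N\<^esub> ind_res_counit G H N t) \<in> hom (ind_group (res_module H N)) (add_monoid N)"
      using hom_compose[OF counit(1) smult_hom[OF z]] by (simp add: o_def)
    show "t \<in> carrier (ind_group (res_module H N))" using t by simp
    show "ind_res_counit G H N (\<zeta> \<odot>\<^bsub>?I\<^esub> ind_tensor G H (res_module H N) \<xi> n)
        = \<zeta> \<odot>\<^bsub>N\<^esub> ind_res_counit G H N (ind_tensor G H (res_module H N) \<xi> n)"
      if "\<xi> \<in> carrier (ind_bimodule G H)" "n \<in> carrier (res_module H N)" for \<xi> n
      using that z smult_assoc[of \<zeta> \<xi> n] res_module_subset[OF N]
      by (simp add: ind_smult_hom(2)[OF R z] counit(2) bimodule_left_closed)
  qed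
qed

lemma ind_res_counit_natural:
  assumes N: "groupoid_module G N" "groupoid_module G N'" and f: "f \<in> groupoid_maps G N N'"
    and t: "t \<in> carrier (ind_group (res_module H N))"
  shows "f (ind_res_counit G H N t)
    = ind_res_counit G H N' (ind_map G H (res_module H N') (res_map H N f) t)"
proof -
  interpret N': nd_module "groupoid_ring G" N' using N(2) by (rule nd_module.intro)
  note R = groupoid_module_res[OF N(1)] and R' = groupoid_module_res[OF N(2)]
  note rf = res_map_module_map[OF N f]
  show ?thesis
  proof (rule ind_hom_eqI[OF R _ _ N'.a_group _ t])
    show "(\<lambda>t. f (ind_res_counit G H N t)) \<in> hom (ind_group (res_module H N)) (add_monoid N')"
      using hom_compose[OF ind_res_counit_hom(1)[OF N(1)] module_maps_hom[OF f]] by (simp add: o_def)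
    show "(\<lambda>t. ind_res_counit G H N' (ind_map G H (res_module H N') (res_map H N f) t))
        \<in> hom (ind_group (res_module H N)) (add_monoid N')"
      using hom_compose[OF ind_map_hom(1)[OF R R' rf] ind_res_counit_hom(1)[OF N(2)]] by (simp add: o_def)
    show "f (ind_res_counit G H N (ind_tensor G H (res_module H N) \<xi> n))
        = ind_res_counit G H N' (ind_map G H (res_module H N') (res_map H N f) (ind_tensor G H (res_module H N) \<xi> n))"
      if "\<xi> \<in> carrier (ind_bimodule G H)" "n \<in> carrier (res_module H N)" for \<xi> n
      using that module_map_res[OF N f] module_maps_smult[OF f, of \<xi> n] res_module_subset[OF N(1)]
      by (simp add: ind_res_counit_hom(2)[OF N(1)] ind_res_counit_hom(2)[OF N(2)] ind_map_hom(2)[OF R R' rf] res_map_eq)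
  qed
qed

section \<open>The adjunction\<close>

text \<open>On a pure tensor, with \<open>e \<odot> m = m\<close>:
  \<open>\<xi> \<otimes> m \<mapsto> \<xi> \<otimes> (e \<otimes> m) \<mapsto> \<xi> \<odot> (e \<otimes> m) = \<xi>e \<otimes> m = \<xi> \<otimes> e \<odot> m = \<xi> \<otimes> m\<close>.\<close>

lemma triangle_ind:
  assumes M: "groupoid_module H M" and t: "t \<in> carrier (ind_group M)"
  shows "ind_res_counit G H (ind_module G H M)
    (ind_map G H (res_module H (ind_module G H M)) (ind_res_unit G H M) t) = t"
proof -
  let ?I = "ind_module G H M"
  note I = groupoid_module_ind[OF M]
  note R = groupoid_module_res[OF I] and u = ind_res_unit_module_map[OF M]
  interpret T: comm_group "ind_group M" by (rule comm_group_ind[OF M])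
  show ?thesis
  proof (rule ind_hom_eqI[OF M _ _ T.is_group _ t])
    have "ind_res_counit G H ?I \<in> hom (ind_group (res_module H ?I)) (ind_group M)"
      using ind_res_counit_hom(1)[OF I] by (simp add: hom_def)
    from hom_compose[OF ind_map_hom(1)[OF M R u] this]
    show "(\<lambda>t. ind_res_counit G H ?I (ind_map G H (res_module H ?I) (ind_res_unit G H M) t))
        \<in> hom (ind_group M) (ind_group M)" by (simp add: o_def)
    show "(\<lambda>t. t) \<in> hom (ind_group M) (ind_group M)" by (simp add: hom_def)
    fix \<xi> m assume x: "\<xi> \<in> carrier (ind_bimodule G H)" and m: "m \<in> carrier M"
    obtain e where e: "e \<in> carrier (groupoid_ring H)" "e \<odot>\<^bsub>M\<^esub> m = m"
      using H_module_local_unit[OF M m] by blast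
    have "ind_res_counit G H ?I (ind_map G H (res_module H ?I) (ind_res_unit G H M) (ind_tensor G H M \<xi> m))
        = ind_res_counit G H ?I (ind_tensor G H (res_module H ?I) \<xi> (ind_res_unit G H M m))"
      using ind_map_hom(2)[OF M R u x m] by simp
    also have "\<dots> = \<xi> \<odot>\<^bsub>?I\<^esub> ind_res_unit G H M m"
      by (rule ind_res_counit_hom(2)[OF I x module_maps_closed[OF u m]])
    also have "\<dots> = \<xi> \<odot>\<^bsub>?I\<^esub> ind_tensor G H M e m"
      by (simp add: ind_res_unit_local_unit[OF M e(1) m e(2)])
    also have "\<dots> = ind_tensor G H M (convolution G \<xi> e) m"
      by (rule ind_smult_hom(2)[OF M bimodule_in_ring_G[OF x] ring_H_in_bimodule[OF e(1)] m])
    also have "\<dots> = ind_tensor G H M \<xi> m"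
      using ind_tensor_balanced[OF M x e(1) m] e(2) by simp
    finally show "ind_res_counit G H ?I (ind_map G H (res_module H ?I) (ind_res_unit G H M) (ind_tensor G H M \<xi> m))
        = ind_tensor G H M \<xi> m" .
  qed
qed

lemma triangle_res:
  assumes N: "groupoid_module G N" and n: "n \<in> carrier (res_module H N)"
  shows "res_map H (ind_module G H (res_module H N)) (ind_res_counit G H N)
    (ind_res_unit G H (res_module H N) n) = n"
proof -
  note R = groupoid_module_res[OF N]
  obtain e where e: "e \<in> carrier (groupoid_ring H)" "e \<odot>\<^bsub>res_module H N\<^esub> n = n"
    using H_module_local_unit[OF R n] by blast
  have "res_map H (ind_module G H (res_module H N)) (ind_res_counit G H N) (ind_res_unit G H (res_module H N) n)
      = ind_res_counit G H N (ind_tensor G H (res_module H N) e n)"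
    unfolding ind_res_unit_local_unit[OF R e(1) n e(2)]
    by (rule res_map_eq[OF ind_tensor_in_res[OF R e(1) n]])
  also have "\<dots> = e \<odot>\<^bsub>N\<^esub> n"
    by (rule ind_res_counit_hom(2)[OF N ring_H_in_bimodule[OF e(1)] n])
  finally show ?thesis using e(2) by simp
qed

end

theorem proposition2p18:
  fixes G H :: "'g groupoid"
  assumes "ample_groupoid G" and "open_subgroupoid H G"
  shows
    "\<comment> \<open>\<open>Ind\<close> is a functor\<close>
    ((\<forall>M :: ('g \<Rightarrow> int, 'a) module. groupoid_module H M \<longrightarrow>
         groupoid_module G (ind_module G H M)
       \<and> (\<forall>t\<in>carrier (ind_module G H M). ind_map G H M (\<lambda>m. m) t = t))
    \<and> (\<forall>(M :: ('g \<Rightarrow> int, 'a) module) (M' :: ('g \<Rightarrow> int, 'b) module) f.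
         groupoid_module H M \<and> groupoid_module H M' \<and> f \<in> groupoid_maps H M M' \<longrightarrow>
         ind_map G H M' f \<in> groupoid_maps G (ind_module G H M) (ind_module G H M'))
    \<and> (\<forall>(M :: ('g \<Rightarrow> int, 'a) module) (M' :: ('g \<Rightarrow> int, 'b) module)
         (M'' :: ('g \<Rightarrow> int, 'c) module) f f'.
         groupoid_module H M \<and> groupoid_module H M' \<and> groupoid_module H M''
         \<and> f \<in> groupoid_maps H M M' \<and> f' \<in> groupoid_maps H M' M'' \<longrightarrow>
         (\<forall>t\<in>carrier (ind_module G H M).
            ind_map G H M'' (\<lambda>m. f' (f m)) t = ind_map G H M'' f' (ind_map G H M' f t))))
  \<and>
    \<comment> \<open>\<open>Res\<close> is a functor\<close>
    ((\<forall>N :: ('g \<Rightarrow> int, 'p) module. groupoid_module G N \<longrightarrow>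
         groupoid_module H (res_module H N)
       \<and> (\<forall>n\<in>carrier (res_module H N). res_map H N (\<lambda>n. n) n = n))
    \<and> (\<forall>(N :: ('g \<Rightarrow> int, 'p) module) (N' :: ('g \<Rightarrow> int, 'q) module) f.
         groupoid_module G N \<and> groupoid_module G N' \<and> f \<in> groupoid_maps G N N' \<longrightarrow>
         res_map H N f \<in> groupoid_maps H (res_module H N) (res_module H N'))
    \<and> (\<forall>(N :: ('g \<Rightarrow> int, 'p) module) (N' :: ('g \<Rightarrow> int, 'q) module)
         (N'' :: ('g \<Rightarrow> int, 's) module) f f'.
         groupoid_module G N \<and> groupoid_module G N' \<and> groupoid_module G N''
         \<and> f \<in> groupoid_maps G N N' \<and> f' \<in> groupoid_maps G N' N'' \<longrightarrow>
         (\<forall>n\<in>carrier (res_module H N).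
            res_map H N (\<lambda>n. f' (f n)) n = res_map H N' f' (res_map H N f n))))
  \<and>
    \<comment> \<open>the unit is a natural transformation, with the stated formula\<close>
    ((\<forall>M :: ('g \<Rightarrow> int, 'a) module. groupoid_module H M \<longrightarrow>
         ind_res_unit G H M \<in> groupoid_maps H M (res_module H (ind_module G H M))
       \<and> (\<forall>\<zeta>\<in>carrier (groupoid_ring H). \<forall>m\<in>carrier M.
            ind_res_unit G H M (\<zeta> \<odot>\<^bsub>M\<^esub> m) = ind_tensor G H M \<zeta> m))
    \<and> (\<forall>(M :: ('g \<Rightarrow> int, 'a) module) (M' :: ('g \<Rightarrow> int, 'b) module) f.
         groupoid_module H M \<and> groupoid_module H M' \<and> f \<in> groupoid_maps H M M' \<longrightarrow>
         (\<forall>m\<in>carrier M. ind_res_unit G H M' (f m)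
            = res_map H (ind_module G H M) (ind_map G H M' f) (ind_res_unit G H M m))))
  \<and>
    \<comment> \<open>the counit is a natural transformation, with the stated formula\<close>
    ((\<forall>N :: ('g \<Rightarrow> int, 'p) module. groupoid_module G N \<longrightarrow>
         ind_res_counit G H N \<in> groupoid_maps G (ind_module G H (res_module H N)) N
       \<and> (\<forall>\<xi>\<in>carrier (ind_bimodule G H). \<forall>n\<in>carrier (res_module H N).
            ind_res_counit G H N (ind_tensor G H (res_module H N) \<xi> n) = \<xi> \<odot>\<^bsub>N\<^esub> n))
    \<and> (\<forall>(N :: ('g \<Rightarrow> int, 'p) module) (N' :: ('g \<Rightarrow> int, 'q) module) f.
         groupoid_module G N \<and> groupoid_module G N' \<and> f \<in> groupoid_maps G N N' \<longrightarrow>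
         (\<forall>t\<in>carrier (ind_module G H (res_module H N)).
            f (ind_res_counit G H N t)
            = ind_res_counit G H N' (ind_map G H (res_module H N') (res_map H N f) t))))
  \<and>
    \<comment> \<open>the triangle identities\<close>
    ((\<forall>M :: ('g \<Rightarrow> int, 'a) module. groupoid_module H M \<longrightarrow>
         (\<forall>t\<in>carrier (ind_module G H M).
            ind_res_counit G H (ind_module G H M)
              (ind_map G H (res_module H (ind_module G H M)) (ind_res_unit G H M) t) = t))
    \<and> (\<forall>N :: ('g \<Rightarrow> int, 'p) module. groupoid_module G N \<longrightarrow>
         (\<forall>n\<in>carrier (res_module H N).
            res_map H (ind_module G H (res_module H N)) (ind_res_counit G H N)
              (ind_res_unit G H (res_module H N) n) = n)))"
proof -
  interpret ample_open_subgroupoid G H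
    using assms by unfold_locales
  show ?thesis
    by (intro conjI allI impI ballI; (elim conjE)?)
      (simp_all add: groupoid_module_ind ind_map_id ind_map_module_map ind_map_compose
        groupoid_module_res res_map_eq res_map_module_map module_map_res
        ind_res_unit_module_map ind_res_unit_tensor ind_res_unit_natural
        ind_res_counit_module_map ind_res_counit_hom(2) ind_res_counit_natural
        triangle_ind triangle_res)
qed

end
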